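(* Let $p$ be a prime and let $f$ be a nondegenerate $n$-ary quadratic form over $\mathbb{Z}_p$ that is ADC (e.g. corresponding to a maximal lattice). Suppose that $n=3$ or $p>2$. Then either $\delta_p(f)=1$, or $\delta_p(f)$ is a rational number with negative $2$-adic valuation.
   Context: $f$ over $\mathbb{Z}_p$ is ADC if every $x\in\mathbb{Z}_p$ of the form $f(w)$ with $w\in\mathbb{Q}_p^n$ is of the form $f(w')$ with $w'\in\mathbb{Z}_p^n$. $\delta_p(f)\coloneqq\mu_p(f(\mathbb{Z}_p^n))$ where $\mu_p$ is the Haar measure on $\mathbb{Z}_p$ with $\mu_p(\mathbb{Z}_p)=1$. *)

theory Defs
  imports
    "HOL-Probability.Probability"
    "HOL-Computational_Algebra.Computational_Algebra"
    "Berlekamp_Zassenhaus.Finite_Field"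
begin

text \<open>The prime \<open>p\<close> is the cardinality of a type \<open>'p :: prime_card\<close>, as for the finite prime fields
  \<open>'p mod_ring\<close>. The ring \<open>\<int>\<^sub>p\<close> is the inverse limit of the rings \<open>\<int>/p\<^sup>n\<close>: the value at \<open>n\<close> of
  a coherent sequence is the representative in \<open>{0..<p\<^sup>n}\<close> of the residue modulo \<open>p\<^sup>n\<close>.\<close>

typedef (overloaded) 'p padic_int =
  "{a :: nat \<Rightarrow> int. \<forall>n. a n = a (Suc n) mod int CARD('p :: prime_card) ^ n}"
  morphisms padic_res Abs_padic_int
  by (rule exI[of _ "\<lambda>_. 0"]) simp

setup_lifting type_definition_padic_int

lemma padic_coherent_mod:
  fixes P :: int
  assumes "k mod P ^ n = l mod P ^ n"
  shows "k mod P ^ n = (l mod P ^ Suc n) mod P ^ n"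
  using assms by (simp add: mod_mod_cancel)

lemma padic_res_mod:
  fixes x :: "'p :: prime_card padic_int"
  assumes "m \<le> n"
  shows "padic_res x n mod int CARD('p) ^ m = padic_res x m"
  using assms
proof (induction n rule: dec_induct)
  case base
  have "padic_res x m = padic_res x (Suc m) mod int CARD('p) ^ m"
    using padic_res[of x] by blast
  then show ?case by (metis mod_mod_trivial)
next
  case (step n)
  have "padic_res x n = padic_res x (Suc n) mod int CARD('p) ^ n"
    using padic_res[of x] by blast
  with step show ?case
    by (metis le_imp_power_dvd mod_mod_cancel)
qed

lemma padic_res_bounds:
  fixes x :: "'p :: prime_card padic_int"
  shows "0 \<le> padic_res x n" "padic_res x n < int CARD('p) ^ n"
proof -
  have *: "int CARD('p) ^ n > 0"
    using prime_gt_0_nat[OF prime_card[where 'a = 'p]] by simp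
  have "padic_res x n = padic_res x n mod int CARD('p) ^ n"
    using padic_res_mod[of n n x] by simp
  with * show "0 \<le> padic_res x n" "padic_res x n < int CARD('p) ^ n"
    by (metis pos_mod_sign, metis pos_mod_bound)
qed

lemma padic_res_mod_self [simp]:
  fixes x :: "'p :: prime_card padic_int"
  shows "padic_res x n mod int CARD('p) ^ n = padic_res x n"
  by (rule padic_res_mod) simp

lemma padic_res_0 [simp]: "padic_res x 0 = 0"
  using padic_res_bounds[of x 0] by simp

lemma padic_int_eqI: "(\<And>n. padic_res x n = padic_res y n) \<Longrightarrow> x = y"
  by (simp add: fun_eq_iff flip: padic_res_inject)

instantiation padic_int :: (prime_card) comm_ring_1
begin

lift_definition zero_padic_int :: "'a padic_int" is "\<lambda>_. 0"
  by simp

lift_definition one_padic_int :: "'a padic_int" is "\<lambda>n. 1 mod int CARD('a) ^ n"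
  by (rule padic_coherent_mod) simp

lift_definition plus_padic_int :: "'a padic_int \<Rightarrow> 'a padic_int \<Rightarrow> 'a padic_int"
  is "\<lambda>a b n. (a n + b n) mod int CARD('a) ^ n"
proof (rule padic_coherent_mod)
  fix a b :: "nat \<Rightarrow> int" and n :: nat
  assume "\<And>n. a n = a (Suc n) mod int CARD('a) ^ n" "\<And>n. b n = b (Suc n) mod int CARD('a) ^ n"
  then have "a n = a (Suc n) mod int CARD('a) ^ n" "b n = b (Suc n) mod int CARD('a) ^ n"
    by blast+
  then show "(a n + b n) mod int CARD('a) ^ n = (a (Suc n) + b (Suc n)) mod int CARD('a) ^ n"
    by (simp only: mod_add_eq)
qed

lift_definition minus_padic_int :: "'a padic_int \<Rightarrow> 'a padic_int \<Rightarrow> 'a padic_int"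
  is "\<lambda>a b n. (a n - b n) mod int CARD('a) ^ n"
proof (rule padic_coherent_mod)
  fix a b :: "nat \<Rightarrow> int" and n :: nat
  assume "\<And>n. a n = a (Suc n) mod int CARD('a) ^ n" "\<And>n. b n = b (Suc n) mod int CARD('a) ^ n"
  then have "a n = a (Suc n) mod int CARD('a) ^ n" "b n = b (Suc n) mod int CARD('a) ^ n"
    by blast+
  then show "(a n - b n) mod int CARD('a) ^ n = (a (Suc n) - b (Suc n)) mod int CARD('a) ^ n"
    by (simp only: mod_diff_eq)
qed

lift_definition uminus_padic_int :: "'a padic_int \<Rightarrow> 'a padic_int"
  is "\<lambda>a n. (- a n) mod int CARD('a) ^ n"
proof (rule padic_coherent_mod)
  fix a :: "nat \<Rightarrow> int" and n :: nat
  assume "\<And>n. a n = a (Suc n) mod int CARD('a) ^ n"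
  then have "a n = a (Suc n) mod int CARD('a) ^ n"
    by blast
  then show "(- a n) mod int CARD('a) ^ n = (- a (Suc n)) mod int CARD('a) ^ n"
    by (simp only: mod_minus_eq)
qed

lift_definition times_padic_int :: "'a padic_int \<Rightarrow> 'a padic_int \<Rightarrow> 'a padic_int"
  is "\<lambda>a b n. (a n * b n) mod int CARD('a) ^ n"
proof (rule padic_coherent_mod)
  fix a b :: "nat \<Rightarrow> int" and n :: nat
  assume "\<And>n. a n = a (Suc n) mod int CARD('a) ^ n" "\<And>n. b n = b (Suc n) mod int CARD('a) ^ n"
  then have "a n = a (Suc n) mod int CARD('a) ^ n" "b n = b (Suc n) mod int CARD('a) ^ n"
    by blast+
  then show "(a n * b n) mod int CARD('a) ^ n = (a (Suc n) * b (Suc n)) mod int CARD('a) ^ n"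
    by (simp only: mod_mult_eq)
qed

lemmas padic_res_ring =
  zero_padic_int.rep_eq one_padic_int.rep_eq plus_padic_int.rep_eq
  minus_padic_int.rep_eq uminus_padic_int.rep_eq times_padic_int.rep_eq

instance
proof
  fix a b c :: "'a padic_int"
  show "a * b * c = a * (b * c)"
    by (rule padic_int_eqI) (simp add: padic_res_ring mod_simps mult.assoc)
  show "a * b = b * a"
    by (rule padic_int_eqI) (simp add: padic_res_ring mult.commute)
  show "1 * a = a"
    by (rule padic_int_eqI) (simp add: padic_res_ring mod_simps)
  show "a + b + c = a + (b + c)"
    by (rule padic_int_eqI) (simp add: padic_res_ring mod_simps add.assoc)
  show "a + b = b + a"
    by (rule padic_int_eqI) (simp add: padic_res_ring add.commute)
  show "0 + a = a"
    by (rule padic_int_eqI) (simp add: padic_res_ring)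
  show "- a + a = 0"
    by (rule padic_int_eqI) (simp add: padic_res_ring mod_simps)
  show "a - b = a + - b"
    by (rule padic_int_eqI) (simp add: padic_res_ring mod_simps)
  show "(a + b) * c = a * c + b * c"
    by (rule padic_int_eqI) (simp add: padic_res_ring mod_simps distrib_right)
  have "padic_res (0 :: 'a padic_int) 1 \<noteq> padic_res 1 1"
    using prime_gt_1_nat[OF prime_card[where 'a = 'a]] by (simp add: padic_res_ring)
  then show "(0 :: 'a padic_int) \<noteq> 1"
    by metis
qed

end

instance padic_int :: (prime_card) idom
proof
  fix a b :: "'a padic_int"
  assume "a \<noteq> 0" "b \<noteq> 0"
  let ?p = "int CARD('a)"
  have p: "prime ?p"
    using prime_card[where 'a = 'a] by simp
  obtain m n where "padic_res a m \<noteq> 0" "padic_res b n \<noteq> 0"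
    using \<open>a \<noteq> 0\<close> \<open>b \<noteq> 0\<close> padic_int_eqI[of a 0] padic_int_eqI[of b 0]
    by (auto simp: padic_res_ring)
  then have nd: "\<not> ?p ^ m dvd padic_res a (m + n)" "\<not> ?p ^ n dvd padic_res b (m + n)"
    using padic_res_mod[of m "m + n" a] padic_res_mod[of n "m + n" b]
    by (auto simp: dvd_eq_mod_eq_0)
  then have nz: "padic_res a (m + n) \<noteq> 0" "padic_res b (m + n) \<noteq> 0"
    by auto
  have "multiplicity ?p (padic_res a (m + n)) < m" "multiplicity ?p (padic_res b (m + n)) < n"
    using nd multiplicity_dvd' by (metis not_le)+
  then have "multiplicity ?p (padic_res a (m + n) * padic_res b (m + n)) < m + n"
    using nz p by (simp add: prime_elem_multiplicity_mult_distrib)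
  then have "\<not> ?p ^ (m + n) dvd padic_res a (m + n) * padic_res b (m + n)"
    using nz p by (metis mult_eq_0_iff multiplicity_geI not_le not_prime_unit)
  then have "padic_res (a * b) (m + n) \<noteq> 0"
    by (simp add: times_padic_int.rep_eq dvd_eq_mod_eq_0)
  then show "a * b \<noteq> 0"
    by (auto simp: zero_padic_int.rep_eq)
qed

text \<open>The \<open>p\<close>-adic topology: the residue classes modulo the powers of \<open>p\<close> form a base.\<close>

instantiation padic_int :: (prime_card) topological_space
begin

definition open_padic_int :: "'a padic_int set \<Rightarrow> bool" where
  "open_padic_int U \<longleftrightarrow> (\<forall>x\<in>U. \<exists>n. \<forall>y. padic_res y n = padic_res x n \<longrightarrow> y \<in> U)"

instance
proof
  show "open (UNIV :: 'a padic_int set)"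
    by (simp add: open_padic_int_def)
next
  fix S T :: "'a padic_int set"
  assume S: "open S" and T: "open T"
  show "open (S \<inter> T)"
    unfolding open_padic_int_def
  proof
    fix x assume "x \<in> S \<inter> T"
    then obtain m n where
      m: "\<And>y. padic_res y m = padic_res x m \<Longrightarrow> y \<in> S" and
      n: "\<And>y. padic_res y n = padic_res x n \<Longrightarrow> y \<in> T"
      using S T unfolding open_padic_int_def by blast
    have "y \<in> S \<inter> T" if "padic_res y (max m n) = padic_res x (max m n)" for y
      using that m[of y] n[of y] by (metis IntI max.cobounded1 max.cobounded2 padic_res_mod)
    then show "\<exists>n. \<forall>y. padic_res y n = padic_res x n \<longrightarrow> y \<in> S \<inter> T"
      by blast
  qed
next
  fix K :: "'a padic_int set set"
  assume K: "\<forall>S\<in>K. open S"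
  show "open (\<Union>K)"
    unfolding open_padic_int_def
  proof
    fix x assume "x \<in> \<Union>K"
    then obtain S where S: "S \<in> K" "x \<in> S"
      by blast
    with K have "open S"
      by blast
    with S(2) obtain n where "\<And>y. padic_res y n = padic_res x n \<Longrightarrow> y \<in> S"
      unfolding open_padic_int_def by blast
    with S(1) show "\<exists>n. \<forall>y. padic_res y n = padic_res x n \<longrightarrow> y \<in> \<Union>K"
      by blast
  qed
qed

end

type_synonym 'p padic = "'p padic_int fract"

definition normalized_haar :: "'p :: prime_card padic_int measure \<Rightarrow> bool" where
  "normalized_haar \<mu> \<longleftrightarrow>
     sets \<mu> = sets borel \<and>
     (\<forall>a. \<forall>A\<in>sets borel. emeasure \<mu> ((+) a ` A) = emeasure \<mu> A) \<and>
     emeasure \<mu> UNIV = 1"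

definition padic_haar :: "'p :: prime_card padic_int measure" where
  "padic_haar = (THE \<mu>. normalized_haar \<mu>)"

subsection \<open>Existence and uniqueness of the Haar measure\<close>

abbreviation residue_class :: "'p :: prime_card padic_int \<Rightarrow> nat \<Rightarrow> 'p padic_int set" where
  "residue_class x n \<equiv> {y. padic_res y n = padic_res x n}"

definition residue_classes :: "'p :: prime_card padic_int set set" where
  "residue_classes = range (\<lambda>(n, r). {y. padic_res y n = r})"

lemma residue_class_in: "{y. padic_res y n = r} \<in> residue_classes"
  unfolding residue_classes_def by (rule range_eqI[of _ _ "(n, r)"]) simp

lemma open_residue_class: "open {y :: 'p :: prime_card padic_int. padic_res y n = r}"
  by (auto simp: open_padic_int_def)

lemma Int_stable_residue_classes: "Int_stable (residue_classes :: 'p :: prime_card padic_int set set)"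
proof (rule Int_stableI)
  have *: "{y :: 'p padic_int. padic_res y m = r} \<inter> {y. padic_res y n = s} \<in> residue_classes"
    if "m \<le> n" for m n and r s :: int
  proof (cases "s mod int CARD('p) ^ m = r")
    case True
    then have "{y :: 'p padic_int. padic_res y m = r} \<inter> {y. padic_res y n = s} = {y. padic_res y n = s}"
      using padic_res_mod[where 'p = 'p, OF that] by auto
    then show ?thesis by (simp add: residue_class_in)
  next
    case False
    then have "{y :: 'p padic_int. padic_res y m = r} \<inter> {y. padic_res y n = s} = {y. padic_res y 0 = 1}"
      using padic_res_mod[where 'p = 'p, OF that] by auto
    then show ?thesis by (simp only: residue_class_in)
  qed
  fix A B :: "'p padic_int set"
  assume "A \<in> residue_classes" "B \<in> residue_classes"
  then obtain m r n s where AB: "A = {y. padic_res y m = r}" "B = {y. padic_res y n = s}"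
    unfolding residue_classes_def by auto
  show "A \<inter> B \<in> residue_classes"
    using *[of m n r s] *[of n m s r] AB by (metis Int_commute nat_le_linear)
qed

lemma sets_borel_padic_int:
  "sets (borel :: 'p :: prime_card padic_int measure) = sigma_sets UNIV residue_classes"
proof -
  have count: "countable (residue_classes :: 'p padic_int set set)"
    unfolding residue_classes_def by simp
  have "U \<in> sigma_sets UNIV residue_classes" if U: "open U" for U :: "'p padic_int set"
  proof -
    let ?F = "{C \<in> residue_classes. C \<subseteq> U}"
    have "U \<subseteq> \<Union>?F"
    proof
      fix x assume "x \<in> U"
      then obtain n where "residue_class x n \<subseteq> U"
        using U unfolding open_padic_int_def by blast
      then show "x \<in> \<Union>?F"
        using residue_class_in[of n "padic_res x n"] by blast
    qed
    then have "U = \<Union>?F" by blast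
    moreover have "\<Union>?F \<in> sigma_sets UNIV residue_classes"
      by (rule sigma_sets_UNION) (auto intro: countable_subset[OF _ count])
    ultimately show ?thesis by simp
  qed
  moreover have "C \<in> sets borel" if "C \<in> residue_classes" for C :: "'p padic_int set"
    using that open_residue_class unfolding residue_classes_def by (auto intro: borel_open)
  ultimately show ?thesis
    unfolding borel_def
    by (auto simp: sets_measure_of intro!: sigma_sets_eqI)
qed

lemma padic_measure_eqI:
  fixes M N :: "'p :: prime_card padic_int measure"
  assumes "sets M = sets borel" "sets N = sets borel" "emeasure M UNIV = 1"
    and "\<And>n (x :: 'p padic_int). emeasure M (residue_class x n) = emeasure N (residue_class x n)"
  shows "M = N"
proof (rule measure_eqI_generator_eq[OF Int_stable_residue_classes, where \<Omega> = UNIV])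
  fix X :: "'p padic_int set"
  assume "X \<in> residue_classes"
  then obtain n r where X: "X = {y. padic_res y n = r}"
    unfolding residue_classes_def by auto
  show "emeasure M X = emeasure N X"
  proof (cases "X = {}")
    case False
    then obtain x :: "'p padic_int" where "padic_res x n = r" using X by auto
    then show ?thesis using assms(4)[of n x] X by simp
  qed simp
next
  have "(UNIV :: 'p padic_int set) = {y. padic_res y 0 = 0}"
    by simp
  then show "range (\<lambda>_ :: nat. UNIV :: 'p padic_int set) \<subseteq> residue_classes"
    using residue_class_in[of 0 0] by auto
qed (use assms sets_borel_padic_int in auto)

lemma padic_res_of_nat: "padic_res (of_nat k :: 'p :: prime_card padic_int) n = int k mod int CARD('p) ^ n"
  by (induction k) (auto simp: zero_padic_int.rep_eq one_padic_int.rep_eq plus_padic_int.rep_eq mod_simps)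

lemma translate_residue_class:
  fixes x :: "'p :: prime_card padic_int"
  shows "(+) x ` residue_class z n = residue_class (x + z) n"
proof -
  have "padic_res (x + y) n = padic_res (x + z) n" if "padic_res y n = padic_res z n" for x y z :: "'p padic_int"
    using that by (simp add: plus_padic_int.rep_eq)
  note cong = this
  show ?thesis
  proof (intro equalityI subsetI)
    fix y assume "y \<in> (+) x ` residue_class z n"
    then obtain w where "y = x + w" "padic_res w n = padic_res z n"
      by blast
    then show "y \<in> residue_class (x + z) n"
      using cong[of w z x] by blast
  next
    fix y assume "y \<in> residue_class (x + z) n"
    then have "padic_res (- x + y) n = padic_res (- x + (x + z)) n"
      by (intro cong) simp
    then have "- x + y \<in> residue_class z n"
      by simp
    then have "x + (- x + y) \<in> (+) x ` residue_class z n"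
      by (rule imageI)
    then show "y \<in> (+) x ` residue_class z n"
      by simp
  qed
qed

lemma normalized_haar_residue_class:
  fixes \<mu> :: "'p :: prime_card padic_int measure" and x :: "'p padic_int"
  assumes "normalized_haar \<mu>"
  shows "emeasure \<mu> (residue_class x n) = 1 / of_nat (CARD('p) ^ n)"
proof -
  let ?q = "CARD('p) ^ n"
  define C where "C z = residue_class z n" for z :: "'p padic_int"
  have q: "?q > 0"
    using prime_gt_0_nat[OF prime_card[where 'a = 'p]] by simp
  have sets: "C z \<in> sets \<mu>" for z
    using assms open_residue_class unfolding normalized_haar_def C_def by (auto intro: borel_open)
  have eq: "emeasure \<mu> (C z) = emeasure \<mu> (C 0)" for z
  proof -
    have "C z = (+) z ` C 0"
      using translate_residue_class[of z n 0] by (simp add: C_def)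
    with sets[of 0] assms show ?thesis
      unfolding normalized_haar_def by metis
  qed
  have rk: "padic_res (of_nat k :: 'p padic_int) n = int k" if "k < ?q" for k
    using that by (simp add: padic_res_of_nat flip: of_nat_power)
  have "y \<in> (\<Union>k<?q. C (of_nat k))" for y
  proof -
    have "nat (padic_res y n) < ?q" "int (nat (padic_res y n)) = padic_res y n"
      using padic_res_bounds[of y n] by (auto simp: nat_less_iff)
    then show ?thesis
      using rk[of "nat (padic_res y n)"] unfolding C_def
      by (intro UN_I[of "nat (padic_res y n)"]) simp_all
  qed
  then have "(\<Union>k<?q. C (of_nat k)) = UNIV"
    by blast
  moreover have "disjoint_family_on (\<lambda>k. C (of_nat k)) {..<?q}"
    unfolding disjoint_family_on_def C_def using rk by fastforce
  ultimately have "(\<Sum>k<?q. emeasure \<mu> (C (of_nat k))) = emeasure \<mu> UNIV"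
    using sets by (subst sum_emeasure) auto
  moreover have "(\<Sum>k<?q. emeasure \<mu> (C (of_nat k))) = (\<Sum>k<?q. emeasure \<mu> (C 0))"
    by (rule sum.cong[OF refl eq])
  ultimately have "of_nat ?q * emeasure \<mu> (C 0) = 1"
    using assms by (simp add: normalized_haar_def)
  then have "emeasure \<mu> (C 0) = 1 / of_nat ?q"
    using q mult_divide_eq_ennreal[of "of_nat ?q" "emeasure \<mu> (C 0)"]
    by (simp add: mult.commute ennreal_of_nat_eq_real_of_nat)
  then show ?thesis
    using eq[of x] by (simp add: C_def)
qed

lift_definition padic_of_digits :: "(nat \<Rightarrow> int) \<Rightarrow> 'p :: prime_card padic_int"
  is "\<lambda>d n. (\<Sum>i<n. (d i mod int CARD('p)) * int CARD('p) ^ i) mod int CARD('p) ^ n"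
  by (rule padic_coherent_mod) simp

lemma padic_res_of_digits_eq_iff:
  fixes x :: "'p :: prime_card padic_int"
  shows "padic_res (padic_of_digits d :: 'p padic_int) n = padic_res x n \<longleftrightarrow>
         (\<forall>i<n. d i mod int CARD('p) = padic_res x (Suc i) div int CARD('p) ^ i)"
proof (induction n)
  case 0
  show ?case
    by simp
next
  case (Suc n)
  let ?p = "int CARD('p)" and ?y = "padic_of_digits d :: 'p padic_int"
  have p: "?p > 0"
    using prime_gt_0_nat[OF prime_card[where 'a = 'p]] by simp
  have split: "padic_res z (Suc n) = padic_res z (Suc n) div ?p ^ n * ?p ^ n + padic_res z n"
    for z :: "'p padic_int"
    using padic_res_mod[of n "Suc n" z] div_mult_mod_eq[of "padic_res z (Suc n)" "?p ^ n"] by simp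
  have lt: "(\<Sum>i<k. (d i mod ?p) * ?p ^ i) < ?p ^ k \<and> 0 \<le> (\<Sum>i<k. (d i mod ?p) * ?p ^ i)" for k
  proof (induction k)
    case (Suc k)
    have "(d k mod ?p) * ?p ^ k \<le> (?p - 1) * ?p ^ k"
      using p by (intro mult_right_mono) (auto simp: pos_mod_bound zle_diff1_eq)
    moreover have "0 \<le> (d k mod ?p) * ?p ^ k"
      using p by simp
    ultimately show ?case
      using Suc by (auto simp: algebra_simps)
  qed simp
  then have res: "padic_res ?y k = (\<Sum>i<k. (d i mod ?p) * ?p ^ i)" for k
    by (simp add: padic_of_digits.rep_eq)
  have "padic_res ?y (Suc n) div ?p ^ n = d n mod ?p"
    using lt[of n] p by (simp add: res)
  then have "padic_res ?y (Suc n) = padic_res x (Suc n) \<longleftrightarrow>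
      d n mod ?p = padic_res x (Suc n) div ?p ^ n \<and> padic_res ?y n = padic_res x n"
    using split[of ?y] split[of x] padic_res_mod[of n "Suc n" ?y] padic_res_mod[of n "Suc n" x]
    by (metis lessI less_imp_le_nat)
  with Suc show ?case
    by (auto simp: less_Suc_eq)
qed

lemma ex_normalized_haar: "\<exists>\<mu> :: 'p :: prime_card padic_int measure. normalized_haar \<mu>"
proof -
  let ?p = "int CARD('p)"
  have p: "?p > 0"
    using prime_gt_0_nat[OF prime_card[where 'a = 'p]] by simp
  define U where "U = measure_pmf (pmf_of_set {0..<?p})"
  interpret product_prob_space "\<lambda>_ :: nat. U" UNIV
    unfolding U_def by unfold_locales
  let ?P = "PiM UNIV (\<lambda>_ :: nat. U)"
  have sp: "space ?P = UNIV"
    by (simp add: space_PiM U_def)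
  have digit: "emeasure U {e. e mod ?p = r} = 1 / of_nat CARD('p)" if "0 \<le> r" "r < ?p" for r
  proof -
    have "{0..<?p} \<inter> {e. e mod ?p = r} = {r}"
      using that by auto
    then show ?thesis
      using p unfolding U_def
      by (simp add: emeasure_pmf_of_set ennreal_of_nat_eq_real_of_nat divide_ennreal flip: ennreal_1)
  qed
  have pre: "padic_of_digits -` residue_class x n =
      {d \<in> space ?P. \<forall>i\<in>{..<n}. d i \<in> {e. e mod ?p = padic_res x (Suc i) div ?p ^ i}}"
    for n and x :: "'p padic_int"
    by (auto simp: padic_res_of_digits_eq_iff sp)
  have meas: "padic_of_digits \<in> measurable ?P (borel :: 'p padic_int measure)"
  proof (rule measurable_sigma_sets[OF sets_borel_padic_int])
    fix X :: "'p padic_int set"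
    assume "X \<in> residue_classes"
    then obtain n r where X: "X = {y. padic_res y n = r}"
      unfolding residue_classes_def by auto
    show "padic_of_digits -` X \<inter> space ?P \<in> sets ?P"
    proof (cases "X = {}")
      case False
      then obtain x where X: "X = residue_class x n" using X by auto
      show ?thesis
        unfolding X pre
        by (auto simp: sp U_def intro!: sets.sets_Collect_finite_All')
    qed simp
  qed (auto simp: sp)
  define \<mu> where "\<mu> = distr ?P (borel :: 'p padic_int measure) padic_of_digits"
  have sets: "sets \<mu> = sets borel"
    by (simp add: \<mu>_def)
  have one: "emeasure \<mu> UNIV = 1"
    using P.emeasure_space_1 by (simp add: \<mu>_def emeasure_distr[OF meas] sp)
  have cl: "emeasure \<mu> (residue_class x n) = (1 / of_nat CARD('p)) ^ n" for n x
  proof -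
    have D: "0 \<le> padic_res x (Suc i) div ?p ^ i" "padic_res x (Suc i) div ?p ^ i < ?p" for i
    proof -
      show "0 \<le> padic_res x (Suc i) div ?p ^ i"
        using padic_res_bounds[of x "Suc i"] p by (simp add: pos_imp_zdiv_nonneg_iff)
      have "padic_res x (Suc i) div ?p ^ i * ?p ^ i \<le> padic_res x (Suc i)"
        using div_mult_mod_eq[of "padic_res x (Suc i)" "?p ^ i"] p
        by (smt (verit) pos_mod_sign zero_less_power)
      also have "\<dots> < ?p * ?p ^ i"
        using padic_res_bounds[of x "Suc i"] by simp
      finally show "padic_res x (Suc i) div ?p ^ i < ?p"
        using p by simp
    qed
    have "emeasure \<mu> (residue_class x n) =
        (\<Prod>i<n. emeasure U {e. e mod ?p = padic_res x (Suc i) div ?p ^ i})"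
      unfolding \<mu>_def
      by (subst emeasure_distr[OF meas borel_open[OF open_residue_class]],
          subst sp, subst Int_UNIV_right, subst pre, rule emeasure_PiM_Collect) (auto simp: U_def)
    also have "\<dots> = (1 / of_nat CARD('p)) ^ n"
      using D by (simp add: digit)
    finally show ?thesis .
  qed
  have shift: "(+) a \<in> measurable \<mu> borel" for a :: "'p padic_int"
  proof (rule borel_measurable_continuous_onI[THEN measurable_cong_sets[OF sets refl, THEN equalityD2, THEN subsetD]])
    show "continuous_on UNIV ((+) a)"
      unfolding continuous_on_open_vimage[OF open_UNIV]
    proof safe
      fix B :: "'p padic_int set"
      assume "open B"
      then show "open ((+) a -` B \<inter> UNIV)"
        unfolding open_padic_int_def
        by (auto simp: plus_padic_int.rep_eq) (metis plus_padic_int.rep_eq)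
    qed
  qed
  have inv: "emeasure \<mu> ((+) a ` A) = emeasure \<mu> A" if "A \<in> sets borel" for a A
  proof -
    have img: "(+) a ` B = (+) (- a) -` B" for a :: "'p padic_int" and B
    proof (intro equalityI subsetI)
      fix y assume "y \<in> (+) (- a) -` B"
      then have "a + (- a + y) \<in> (+) a ` B"
        by (intro imageI) simp
      then show "y \<in> (+) a ` B"
        by simp
    qed auto
    have "distr \<mu> borel ((+) (- a)) = \<mu>"
    proof (rule padic_measure_eqI[symmetric])
      show "emeasure \<mu> (residue_class x n) =
          emeasure (distr \<mu> borel ((+) (- a))) (residue_class x n)" for n x
        using cl translate_residue_class[of a n x]
        by (subst emeasure_distr[OF shift borel_open[OF open_residue_class]])
           (simp add: \<mu>_def img)
    qed (simp_all add: sets one)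
    then show ?thesis
      using emeasure_distr[OF shift that, of "- a"] by (simp add: img \<mu>_def)
  qed
  show ?thesis
    unfolding normalized_haar_def using sets one inv by blast
qed

theorem normalized_haar_padic_haar: "normalized_haar (padic_haar :: 'p :: prime_card padic_int measure)"
  unfolding padic_haar_def
proof (rule theI')
  have "\<mu> = \<nu>" if "normalized_haar \<mu>" "normalized_haar \<nu>" for \<mu> \<nu> :: "'p padic_int measure"
    using that
    by (intro padic_measure_eqI)
       (simp_all add: normalized_haar_residue_class, simp_all add: normalized_haar_def)
  then show "\<exists>!\<mu> :: 'p padic_int measure. normalized_haar \<mu>"
    using ex_normalized_haar by blast
qed

subsection \<open>Quadratic forms\<close>

text \<open>A coefficient matrix \<open>c\<close>, not assumed symmetric, stands for the polynomial
  \<open>\<Sum>i j. c\<^sub>i\<^sub>j x\<^sub>i x\<^sub>j\<close>. Every homogeneous quadratic polynomial over the ring arises (take \<open>c\<close>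
  upper triangular), including those whose cross terms have coefficients not divisible by 2.\<close>

definition qform :: "'a :: comm_ring_1 ^ 'n ^ 'n \<Rightarrow> 'a ^ 'n \<Rightarrow> 'a" where
  "qform c x = (\<Sum>i\<in>UNIV. \<Sum>j\<in>UNIV. c $ i $ j * x $ i * x $ j)"

definition polar :: "'a :: comm_ring_1 ^ 'n ^ 'n \<Rightarrow> 'a ^ 'n \<Rightarrow> 'a ^ 'n \<Rightarrow> 'a" where
  "polar c x y = qform c (x + y) - qform c x - qform c y"

definition base_change :: "'a :: idom ^ 'n ^ 'n \<Rightarrow> 'a fract ^ 'n ^ 'n" where
  "base_change c = (\<chi> i j. to_fract (c $ i $ j))"

definition nondegenerate :: "'a :: idom ^ 'n ^ 'n \<Rightarrow> bool" where
  "nondegenerate c \<longleftrightarrow> (\<forall>x. (\<forall>y. polar (base_change c) x y = 0) \<longrightarrow> x = 0)"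

definition ADC :: "'p :: prime_card padic_int ^ 'n ^ 'n \<Rightarrow> bool" where
  "ADC c \<longleftrightarrow>
     (\<forall>x :: 'p padic_int.
        (\<exists>w :: 'p padic ^ 'n. qform (base_change c) w = to_fract x) \<longrightarrow>
        (\<exists>w' :: 'p padic_int ^ 'n. qform c w' = x))"

definition repr_density :: "'p :: prime_card padic_int ^ 'n ^ 'n \<Rightarrow> real" where
  "repr_density c = measure padic_haar (range (qform c))"

text \<open>Only meaningful for \<open>r \<noteq> 0\<close>; at \<open>0\<close>, where the valuation is \<open>\<infinity>\<close>, the value is \<open>0\<close>
  and in particular not negative.\<close>

definition rat_valuation :: "int \<Rightarrow> rat \<Rightarrow> int" where
  "rat_valuation q r =
     int (multiplicity q (fst (quotient_of r))) - int (multiplicity q (snd (quotient_of r)))"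

end

theory Submission
  imports Defs
begin

text \<open>
  Being ADC, the form represents over \<open>\<int>\<^sub>p\<close> exactly the integral elements that it represents over
  \<open>\<rat>\<^sub>p\<close>, so the set of nonzero represented elements is the integral part of a union of square
  classes of \<open>\<rat>\<^sub>p\<close>.

  For \<open>p > 2\<close> there are four square classes; the two of even valuation have integral parts of measure
  \<open>p / (2 (p + 1))\<close> and the two of odd valuation of measure \<open>1 / (2 (p + 1))\<close>. The density is thus
  \<open>(a p + b) / (2 (p + 1))\<close> with \<open>a, b \<le> 2\<close>, and every choice other than \<open>a = b = 0\<close> and
  \<open>a = b = 2\<close> is a quotient of an odd by an even number.

  For \<open>p = 2\<close> the eight square classes have measures \<open>1/6\<close> (even valuation) and \<open>1/12\<close> (odd valuation).
  A nondegenerate ternary form represents at least seven of them, which after diagonalisation is a finite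
  check on the diagonal forms with coefficients \<open>1, 3, 5, 7, 2, 6, 10, 14\<close>; so the density is
  \<open>1\<close>, \<open>5/6\<close> or \<open>11/12\<close>.
\<close>

section \<open>Divisibility and squares in the \<open>p\<close>-adic integers\<close>

abbreviation uniformizer :: "'p :: prime_card padic_int" where
  "uniformizer \<equiv> of_nat CARD('p)"

lemma card_prime_int: "prime (int CARD('p :: prime_card))"
  using prime_card[where 'a = 'p] by simp

lemma card_prime_gt_1: "int CARD('p :: prime_card) > 1"
  by (rule prime_gt_1_int[OF card_prime_int])

lemma padic_res_of_int: "padic_res (of_int k :: 'p :: prime_card padic_int) n = k mod int CARD('p) ^ n"
proof (cases k rule: int_cases2)
  case (nonneg m)
  then show ?thesis by (simp add: padic_res_of_nat)
next
  case (nonpos m)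
  then show ?thesis by (simp add: padic_res_of_nat uminus_padic_int.rep_eq mod_minus_eq)
qed

lemma padic_res_uniformizer_power_mult:
  fixes y :: "'p :: prime_card padic_int"
  shows "padic_res (uniformizer ^ n * y) m = (int CARD('p) ^ n * padic_res y m) mod int CARD('p) ^ m"
proof -
  have "padic_res (uniformizer ^ n :: 'p padic_int) m = (int CARD('p) ^ n) mod int CARD('p) ^ m"
    using padic_res_of_nat[of "CARD('p) ^ n" m, where 'p = 'p] by simp
  then show ?thesis by (simp add: times_padic_int.rep_eq mod_simps)
qed

text \<open>If residue \<open>n\<close> vanishes, all later residues are divisible by p^n. Shifting
  the sequence by \<open>n\<close> and dividing by p^n keeps it coherent, and this sequence is the
  quotient. Residues can thus be traded for divisibility in the ring.\<close>

lemma padic_res_eq_0_iff: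
  fixes x :: "'p :: prime_card padic_int"
  shows "padic_res x n = 0 \<longleftrightarrow> uniformizer ^ n dvd x"
proof
  assume "uniformizer ^ n dvd x"
  then show "padic_res x n = 0"
    by (auto elim!: dvdE simp: padic_res_uniformizer_power_mult)
next
  let ?p = "int CARD('p)"
  assume x: "padic_res x n = 0"
  have p: "?p > 0" using card_prime_gt_1[where 'p = 'p] by simp
  define a where "a m = padic_res x (m + n) div ?p ^ n" for m
  have a: "padic_res x (m + n) = ?p ^ n * a m" for m
  proof -
    have "padic_res x (m + n) mod ?p ^ n = 0"
      using padic_res_mod[of n "m + n" x] x by simp
    then show ?thesis unfolding a_def by (simp add: dvd_eq_mod_eq_0)
  qed
  have coh: "a m = a (Suc m) mod ?p ^ m" for m
  proof -
    have "padic_res x (m + n) = padic_res x (Suc m + n) mod ?p ^ (m + n)"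
      using padic_res_mod[of "m + n" "Suc m + n" x] by simp
    then have "?p ^ n * a m = (?p ^ n * a (Suc m)) mod (?p ^ n * ?p ^ m)"
      by (simp only: a) (simp add: power_add mult.commute)
    then have "?p ^ n * a m = ?p ^ n * (a (Suc m) mod ?p ^ m)"
      by simp
    then show ?thesis using p by simp
  qed
  define y :: "'p padic_int" where "y = Abs_padic_int a"
  have y: "padic_res y m = a m" for m
    unfolding y_def by (subst Abs_padic_int_inverse) (intro CollectI allI coh, rule refl)
  have "x = uniformizer ^ n * y"
  proof (rule padic_int_eqI)
    fix m
    have "padic_res x m = padic_res x (m + n) mod ?p ^ m"
      using padic_res_mod[of m "m + n" x] by simp
    then show "padic_res x m = padic_res (uniformizer ^ n * y) m"
      by (simp only: padic_res_uniformizer_power_mult y a)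
  qed
  then show "uniformizer ^ n dvd x" by simp
qed

lemma padic_res_eq_iff:
  fixes x :: "'p :: prime_card padic_int"
  shows "padic_res x n = padic_res y n \<longleftrightarrow> uniformizer ^ n dvd x - y"
proof -
  have "padic_res x n = padic_res y n \<longleftrightarrow> padic_res x n mod int CARD('p) ^ n = padic_res y n mod int CARD('p) ^ n"
    by simp
  also have "\<dots> \<longleftrightarrow> padic_res (x - y) n = 0"
    by (simp only: mod_eq_dvd_iff minus_padic_int.rep_eq dvd_eq_mod_eq_0)
  finally show ?thesis by (simp add: padic_res_eq_0_iff)
qed

lemma uniformizer_power_dvd_of_int_iff:
  "(uniformizer :: 'p :: prime_card padic_int) ^ n dvd of_int k \<longleftrightarrow> int CARD('p) ^ n dvd k"
  by (simp add: padic_res_of_int dvd_eq_mod_eq_0 flip: padic_res_eq_0_iff)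

lemma uniformizer_power_dvd_of_nat_iff:
  "(uniformizer :: 'p :: prime_card padic_int) ^ n dvd of_nat k \<longleftrightarrow> CARD('p) ^ n dvd k"
  using uniformizer_power_dvd_of_int_iff[of n "int k", where 'p = 'p]
  by (simp flip: of_nat_power)

lemma uniformizer_dvd_of_nat_iff:
  "(uniformizer :: 'p :: prime_card padic_int) dvd of_nat k \<longleftrightarrow> CARD('p) dvd k"
  using uniformizer_power_dvd_of_nat_iff[of 1 k, where 'p = 'p] by simp

instance padic_int :: (prime_card) ring_char_0
proof
  show "inj (of_nat :: nat \<Rightarrow> 'a padic_int)"
  proof
    fix m n :: nat
    assume "(of_nat m :: 'a padic_int) = of_nat n"
    then have *: "int m mod int CARD('a) ^ k = int n mod int CARD('a) ^ k" for k
      by (metis padic_res_of_nat)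
    have p: "CARD('a) \<ge> 2" using prime_ge_2_nat[OF prime_card[where 'a = 'a]] .
    \<comment> \<open>Any exponent with p^k above both \<open>m\<close> and \<open>n\<close> works,
      since reduction modulo p^k then separates them.\<close>
    define k where "k = m + n"
    have "k < 2 ^ k" by simp
    also have "\<dots> \<le> CARD('a) ^ k" using p by (rule power_mono) simp
    finally have "int m < int CARD('a) ^ k" "int n < int CARD('a) ^ k"
      by (simp_all add: k_def flip: of_nat_power)
    with *[of k] show "m = n" by simp
  qed
qed

section \<open>Completeness, units and valuations\<close>

lemma uniformizer_not_unit: "\<not> (uniformizer :: 'p :: prime_card padic_int) dvd 1"
  using uniformizer_dvd_of_nat_iff[of 1, where 'p = 'p] card_prime_gt_1[where 'p = 'p] by auto

text \<open>The limit is the diagonal: residue \<open>n\<close> of the limit is residue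
  \<open>n\<close> of \<open>y n\<close>, and the hypothesis is exactly what makes this
  coherent.\<close>

lemma padic_complete:
  fixes y :: "nat \<Rightarrow> 'p :: prime_card padic_int"
  assumes "\<And>n. uniformizer ^ n dvd y (Suc n) - y n"
  shows "\<exists>z. \<forall>n. uniformizer ^ n dvd z - y n"
proof (intro exI allI)
  have coh: "padic_res (y n) n = padic_res (y (Suc n)) (Suc n) mod int CARD('p) ^ n" for n
    using assms[of n] padic_res_mod[of n "Suc n" "y (Suc n)"] by (simp flip: padic_res_eq_iff)
  have "padic_res (Abs_padic_int (\<lambda>n. padic_res (y n) n) :: 'p padic_int) n = padic_res (y n) n" for n
    by (subst Abs_padic_int_inverse) (intro CollectI allI coh, rule refl)
  then show "uniformizer ^ n dvd (Abs_padic_int (\<lambda>n. padic_res (y n) n) :: 'p padic_int) - y n" for n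
    by (simp flip: padic_res_eq_iff)
qed

lemma padic_eq_0I:
  fixes x :: "'p :: prime_card padic_int"
  assumes "\<And>n. uniformizer ^ n dvd x"
  shows "x = 0"
  using assms by (intro padic_int_eqI) (simp add: zero_padic_int.rep_eq padic_res_eq_0_iff)

text \<open>An inverse is the limit of integers inverting \<open>x\<close> modulo the powers of p;
  these exist by coprimality.\<close>

lemma padic_unit_iff:
  fixes x :: "'p :: prime_card padic_int"
  shows "x dvd 1 \<longleftrightarrow> \<not> uniformizer dvd x"
proof
  assume "x dvd 1"
  then show "\<not> uniformizer dvd x"
    using uniformizer_not_unit dvd_trans by blast
next
  let ?p = "int CARD('p)"
  assume x: "\<not> uniformizer dvd x"
  have "\<exists>c. uniformizer ^ n dvd x * of_int c - 1" for n
  proof -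
    have "\<not> ?p dvd padic_res x n" if "n > 0"
    proof
      assume "?p dvd padic_res x n"
      then have "padic_res x 1 = 0"
        using padic_res_mod[of 1 n x] that by (simp add: dvd_eq_mod_eq_0)
      with x show False by (simp add: padic_res_eq_0_iff)
    qed
    then have "coprime (padic_res x n) (?p ^ n)"
      using prime_imp_coprime[OF card_prime_int[where 'p = 'p], of "padic_res x n"]
      by (cases "n = 0") (auto simp: coprime_commute)
    then obtain c where "[padic_res x n * c = 1] (mod ?p ^ n)"
      using cong_solve_coprime_int by blast
    then have "padic_res (x * of_int c) n = padic_res (1 :: 'p padic_int) n"
      by (simp add: times_padic_int.rep_eq one_padic_int.rep_eq padic_res_of_int cong_def mod_simps)
    then show ?thesis by (auto simp: padic_res_eq_iff)
  qed
  then obtain c where c: "\<And>n. uniformizer ^ n dvd x * of_int (c n) - 1" by metis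
  \<comment> \<open>Invertibility modulo p^n already allows cancelling \<open>x\<close>. Hence
    successive approximate inverses agree to the precision that completeness asks for.\<close>
  have cancel: "uniformizer ^ n dvd z" if "uniformizer ^ n dvd x * z" for n z
  proof -
    have "uniformizer ^ n dvd (x * of_int (c n) - 1) * z - x * z * of_int (c n)"
      using dvd_mult2[OF c[of n], of z] dvd_mult2[OF that, of "of_int (c n)"] by (rule dvd_diff)
    then have "uniformizer ^ n dvd - z" by (simp add: algebra_simps)
    then show ?thesis by simp
  qed
  have step: "uniformizer ^ n dvd of_int (c (Suc n)) - (of_int (c n) :: 'p padic_int)" for n
  proof -
    have "uniformizer ^ n dvd x * of_int (c (Suc n)) - 1"
      using c[of "Suc n"] by (metis dvd_trans le_imp_power_dvd le_SucI order_refl)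
    from dvd_diff[OF this c[of n]] show ?thesis
      by - (rule cancel, simp add: algebra_simps)
  qed
  obtain z where z: "\<And>n. uniformizer ^ n dvd z - (of_int (c n) :: 'p padic_int)"
    using padic_complete[of "\<lambda>n. of_int (c n) :: 'p padic_int", OF step] by metis
  have "x * z - 1 = 0"
  proof (rule padic_eq_0I)
    fix n
    have "uniformizer ^ n dvd x * (z - of_int (c n)) + (x * of_int (c n) - 1)"
      using z[of n] c[of n] by (intro dvd_add dvd_mult)
    then show "uniformizer ^ n dvd x * z - 1" by (simp add: algebra_simps)
  qed
  then have "1 = x * z" by simp
  then show "x dvd 1" ..
qed

text \<open>Only 0 is divisible by every power of the uniformizer, so a nonzero \<open>x\<close> has
  a last power dividing it.\<close>

lemma padic_valuation_cases:
  fixes x :: "'p :: prime_card padic_int"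
  assumes "x \<noteq> 0"
  obtains k v where "x = uniformizer ^ k * v" "\<not> uniformizer dvd v"
proof -
  obtain n where "\<not> uniformizer ^ n dvd x" using assms padic_eq_0I by blast
  then obtain k where k: "\<not> uniformizer ^ Suc k dvd x" "uniformizer ^ k dvd x"
    by (induction n) auto
  then obtain v where v: "x = uniformizer ^ k * v" by blast
  with k have "\<not> uniformizer dvd v" by (auto simp: mult_dvd_mono ac_simps)
  with v show ?thesis by (rule that)
qed

lemma uniformizer_power_dvd_unit_mult:
  fixes v :: "'p :: prime_card padic_int"
  assumes "\<not> uniformizer dvd v"
  shows "uniformizer ^ m dvd uniformizer ^ k * v \<longleftrightarrow> m \<le> k"
proof
  assume *: "uniformizer ^ m dvd uniformizer ^ k * v"
  show "m \<le> k"
  proof (rule ccontr)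
    assume "\<not> m \<le> k"
    then have "uniformizer ^ Suc k dvd uniformizer ^ k * v"
      using * by (metis dvd_trans le_imp_power_dvd not_less_eq_eq)
    then have "uniformizer ^ k * uniformizer dvd uniformizer ^ k * v" by (simp add: ac_simps)
    then have "uniformizer dvd v"
      by (subst (asm) dvd_mult_cancel_left) simp
    with assms show False by simp
  qed
qed (simp add: dvd_mult2 le_imp_power_dvd)

text \<open>The iteration \<open>y \<mapsto> p w - y\<^sup>2\<close> is a contraction near \<open>0\<close>.\<close>

lemma padic_artin_schreier:
  fixes w :: "'p :: prime_card padic_int"
  obtains y where "y * y + y = uniformizer * w"
proof -
  define s where "s = rec_nat 0 (\<lambda>_ y. uniformizer * w - y * y)"
  have s0: "s 0 = 0" and sS: "s (Suc n) = uniformizer * w - s n * s n" for n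
    by (simp_all add: s_def)
  have dvd: "uniformizer dvd s n" for n
    by (induction n) (simp_all add: s0 sS)
  have step: "uniformizer ^ Suc n dvd s (Suc n) - s n" for n
  proof (induction n)
    case 0
    show ?case by (simp add: s0 sS)
  next
    case (Suc n)
    \<comment> \<open>Consecutive differences are, up to sign, differences of squares of earlier
      terms. The factor \<open>s n + s (Suc n)\<close> supplies one more power of p.\<close>
    have "uniformizer dvd s n + s (Suc n)" using dvd by (intro dvd_add)
    then have "uniformizer * uniformizer ^ Suc n dvd (s n + s (Suc n)) * (s (Suc n) - s n)"
      using Suc by (rule mult_dvd_mono)
    also have "(s n + s (Suc n)) * (s (Suc n) - s n) = - (s (Suc (Suc n)) - s (Suc n))"
      by (simp only: sS[of "Suc n"] sS[of n]) (simp add: algebra_simps)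
    finally show ?case by (simp only: dvd_minus_iff power_Suc)
  qed
  then have "uniformizer ^ n dvd s (Suc n) - s n" for n
    by (metis dvd_trans le_imp_power_dvd le_SucI order_refl)
  then obtain y where y: "\<And>n. uniformizer ^ n dvd y - s n"
    using padic_complete[of s] by blast
  have "y * y + y - uniformizer * w = 0"
  proof (rule padic_eq_0I)
    fix n
    have "uniformizer ^ n dvd y - s (Suc n)"
      using y[of "Suc n"] by (metis dvd_trans le_imp_power_dvd le_SucI order_refl)
    \<comment> \<open>By the recursion for \<open>s (Suc n)\<close> this sum equals y^2 + y - p
      w.\<close>
    then have "uniformizer ^ n dvd (y - s n) * (y + s n) + (y - s (Suc n))"
      using y[of n] by (intro dvd_add dvd_mult2)
    then show "uniformizer ^ n dvd y * y + y - uniformizer * w"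
      by (simp add: sS algebra_simps)
  qed
  then show ?thesis using that[of y] by simp
qed

section \<open>Square classes\<close>

definition sq_exponent :: "'p :: prime_card itself \<Rightarrow> nat" where
  "sq_exponent _ = (if CARD('p) = 2 then 3 else 1)"

text \<open>Up to a unit, p to the power \<open>sq_exponent\<close> is 4p: it is 8 at p = 2, and 4
  is a unit for odd p. If u = 1 + 4pw, then completing the square reduces the claim to solving y^2 +
  y = pw, giving u = (1 + 2y)^2.\<close>

lemma padic_square_if_cong_1:
  fixes u :: "'p :: prime_card padic_int"
  assumes "uniformizer ^ sq_exponent TYPE('p) dvd u - 1"
  obtains s where "u = s * s"
proof -
  have "4 * uniformizer dvd u - 1"
  proof (cases "CARD('p) = 2")
    case True
    then show ?thesis using assms by (simp add: sq_exponent_def)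
  next
    case False
    have "\<not> CARD('p) dvd 2 ^ 2"
      using False prime_dvd_power_nat[OF prime_card[where 'a = 'p], of 2 2]
        primes_dvd_imp_eq[OF prime_card[where 'a = 'p] two_is_prime_nat] by auto
    then have "(4 :: 'p padic_int) dvd 1"
      using uniformizer_dvd_of_nat_iff[of 4, where 'p = 'p] by (simp add: padic_unit_iff)
    then have "4 * uniformizer dvd (1 :: 'p padic_int) * uniformizer"
      by (rule mult_dvd_mono) simp
    then show ?thesis
      using assms False dvd_trans[of "4 * uniformizer" uniformizer "u - 1"] by (simp add: sq_exponent_def)
  qed
  then obtain w where w: "u - 1 = 4 * uniformizer * w" by blast
  obtain y where y: "y * y + y = uniformizer * w" by (rule padic_artin_schreier)
  have "u = 1 + 4 * (y * y + y)" using w y by (simp add: algebra_simps)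
  also have "\<dots> = (1 + 2 * y) * (1 + 2 * y)" by (simp add: algebra_simps)
  finally show ?thesis by (rule that)
qed

text \<open>On nonzero elements this says that \<open>S\<close> is the integral part of a union of
  square classes of the fraction field: y = x (a/b)^2 amounts to y b^2 = x a^2, which involves only
  integral elements. Membership of 0 is left free.\<close>

definition sq_closed :: "'p :: prime_card padic_int set \<Rightarrow> bool" where
  "sq_closed S \<longleftrightarrow> (\<forall>x s. s \<noteq> 0 \<longrightarrow> (x * (s * s) \<in> S \<longleftrightarrow> x \<in> S))"

text \<open>Since \<open>v\<close> is a unit, \<open>y\<close> is p^k v times an element congruent
  to 1 modulo p^e, which is a nonzero square. Membership therefore depends only on the leading e
  digits.\<close>

lemma sq_closed_cong:
  fixes S :: "'p :: prime_card padic_int set"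
  assumes S: "sq_closed S" and v: "\<not> uniformizer dvd v"
    and y: "uniformizer ^ (k + sq_exponent TYPE('p)) dvd y - uniformizer ^ k * v"
  shows "y \<in> S \<longleftrightarrow> uniformizer ^ k * v \<in> S"
proof -
  let ?e = "sq_exponent TYPE('p)"
  obtain z where z: "y - uniformizer ^ k * v = uniformizer ^ (k + ?e) * z"
    using y by blast
  have "v dvd 1" using v by (simp add: padic_unit_iff)
  then obtain i where i: "v * i = 1" by (metis dvdE)
  define u where "u = 1 + uniformizer ^ ?e * (i * z)"
  then obtain s where s: "u = s * s"
    using padic_square_if_cong_1[of u] by auto
  have "uniformizer dvd (uniformizer :: 'p padic_int) ^ ?e"
    by (simp add: sq_exponent_def)
  then have "uniformizer dvd uniformizer ^ ?e * (i * z)" by (rule dvd_mult2)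
  then have "u \<noteq> 0"
    unfolding u_def using uniformizer_not_unit
    by (metis dvd_add_left_iff dvd_0_right)
  have "y = uniformizer ^ k * v + uniformizer ^ (k + ?e) * (v * i) * z"
    using z by (simp add: i) (simp add: algebra_simps)
  also have "\<dots> = uniformizer ^ k * v * u"
    unfolding u_def by (simp add: power_add distrib_left ac_simps)
  finally show ?thesis
    using S \<open>u \<noteq> 0\<close> s unfolding sq_closed_def by auto
qed

section \<open>The measure of a union of square classes\<close>

lemma measure_residue_class:
  fixes x :: "'p :: prime_card padic_int"
  shows "measure padic_haar (residue_class x n) = 1 / CARD('p) ^ n"
  by (simp add: measure_def normalized_haar_residue_class[OF normalized_haar_padic_haar]
      ennreal_of_nat_eq_real_of_nat divide_ennreal flip: ennreal_1)

text \<open>Such a set is a finite disjoint union of residue classes modulo p^m, each of measure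
  p^(-m).\<close>

lemma residue_invariant_measure:
  fixes A :: "'p :: prime_card padic_int set"
  assumes inv: "\<And>x y. x \<in> A \<Longrightarrow> uniformizer ^ m dvd y - x \<Longrightarrow> y \<in> A"
  shows "A \<in> sets borel"
    and "measure padic_haar A = card {r. r < CARD('p) ^ m \<and> of_nat r \<in> A} / CARD('p) ^ m"
proof -
  let ?R = "{r. r < CARD('p) ^ m \<and> of_nat r \<in> A}" and ?C = "\<lambda>r. residue_class (of_nat r :: 'p padic_int) m"
  have haar: "normalized_haar (padic_haar :: 'p padic_int measure)"
    by (rule normalized_haar_padic_haar)
  then have sets: "sets padic_haar = sets (borel :: 'p padic_int measure)"
    unfolding normalized_haar_def by blast
  have rk: "padic_res (of_nat r :: 'p padic_int) m = int r" if "r < CARD('p) ^ m" for r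
    using that by (simp add: padic_res_of_nat flip: of_nat_power)
  have A: "A = (\<Union>r\<in>?R. ?C r)"
  proof (intro equalityI subsetI)
    fix x assume x: "x \<in> A"
    define r where "r = nat (padic_res x m)"
    have r: "r < CARD('p) ^ m" "int r = padic_res x m"
      using padic_res_bounds[of x m] by (auto simp: r_def nat_less_iff)
    then have "padic_res (of_nat r :: 'p padic_int) m = padic_res x m" using rk by simp
    moreover from this have "of_nat r \<in> A" using inv[OF x] by (simp add: padic_res_eq_iff)
    ultimately show "x \<in> (\<Union>r\<in>?R. ?C r)" using r by auto
  next
    fix x assume "x \<in> (\<Union>r\<in>?R. ?C r)"
    then obtain r where "of_nat r \<in> A" "padic_res x m = padic_res (of_nat r :: 'p padic_int) m" by blast
    then show "x \<in> A" using inv by (simp add: padic_res_eq_iff)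
  qed
  have C: "?C r \<in> sets borel" for r by (intro borel_open open_residue_class)
  show "A \<in> sets borel" by (subst A, intro sets.finite_UN) (use C in auto)
  have "measure padic_haar A = (\<Sum>r\<in>?R. measure padic_haar (?C r))"
  proof (subst A, rule measure_finite_Union)
    show "disjoint_family_on ?C ?R"
      unfolding disjoint_family_on_def using rk by fastforce
    show "emeasure padic_haar (?C r) \<noteq> \<infinity>" for r
      by (simp add: normalized_haar_residue_class[OF haar] ennreal_divide_eq_top_iff)
  qed (use C sets in auto)
  then show "measure padic_haar A = card ?R / CARD('p) ^ m"
    by (simp add: measure_residue_class)
qed

text \<open>By \<open>sq_closed_cong\<close> these finitely many residues determine the part of a
  square-closed \<open>S\<close> of valuation \<open>k\<close>.\<close>

definition unit_count :: "'p :: prime_card padic_int set \<Rightarrow> nat \<Rightarrow> nat" where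
  "unit_count S k = card {r. r < CARD('p) ^ sq_exponent TYPE('p) \<and> \<not> CARD('p) dvd r
     \<and> of_nat (CARD('p) ^ k * r) \<in> S}"

lemma unit_count_periodic:
  fixes S :: "'p :: prime_card padic_int set"
  assumes "sq_closed S"
  shows "unit_count S (k + 2) = unit_count S k"
proof -
  have "of_nat (CARD('p) ^ (k + 2) * r) \<in> S \<longleftrightarrow> of_nat (CARD('p) ^ k * r) \<in> S" for r
  proof -
    have "of_nat (CARD('p) ^ (k + 2) * r) = of_nat (CARD('p) ^ k * r) * (uniformizer * uniformizer :: 'p padic_int)"
      by (simp add: power_add power2_eq_square algebra_simps)
    then show ?thesis using assms unfolding sq_closed_def
      by (metis of_nat_0_eq_iff zero_less_card_finite less_numeral_extra(3))
  qed
  then show ?thesis unfolding unit_count_def by simp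
qed

text \<open>Split \<open>S\<close> by valuation. The layer at \<open>k\<close> has measure
  \<open>unit_count S k\<close> / q^(k+e), and the counts have period 2 in \<open>k\<close>, so the
  series sums geometrically from its first two terms. The formula is stated with denominators
  cleared.\<close>

lemma sq_closed_measure:
  fixes S :: "'p :: prime_card padic_int set"
  assumes S: "sq_closed S"
  defines "q \<equiv> real CARD('p)" and "e \<equiv> sq_exponent TYPE('p)"
  shows "measure padic_haar S * (q\<^sup>2 - 1) * q ^ e = q * (q * unit_count S 0 + unit_count S 1)"
proof -
  let ?\<mu> = "padic_haar :: 'p padic_int measure"
  have haar: "normalized_haar ?\<mu>" by (rule normalized_haar_padic_haar)
  then have sets: "sets ?\<mu> = sets borel" and one: "emeasure ?\<mu> UNIV = 1"
    unfolding normalized_haar_def by blast+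
  have space: "space ?\<mu> = UNIV" using sets_eq_imp_space_eq[OF sets] by simp
  interpret prob_space ?\<mu> by standard (simp add: space one)
  have q: "q > 1" using card_prime_gt_1[where 'p = 'p] by (simp add: q_def)
  have e: "e > 0" by (simp add: e_def sq_exponent_def)
  define A where "A k = {x \<in> S. uniformizer ^ k dvd x \<and> \<not> uniformizer ^ Suc k dvd x}" for k
  have inv: "y \<in> A k" if x: "x \<in> A k" and y: "uniformizer ^ (k + e) dvd y - x" for k x y
  proof -
    from x obtain v where v: "x = uniformizer ^ k * v" unfolding A_def by blast
    with x have nv: "\<not> uniformizer dvd v" unfolding A_def by (auto simp: mult_dvd_mono ac_simps)
    have "y \<in> S" using sq_closed_cong[OF S nv, of k y] x y v by (simp add: A_def e_def)
    \<comment> \<open>Because e is positive, a congruence modulo p^(k+e) also controls divisibility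
      by p^(k+1), so it preserves valuation \<open>k\<close>.\<close>
    have "uniformizer ^ j dvd y - x" if "j \<le> Suc k" for j
      using y that e by (metis add_Suc_right add.right_neutral add_le_cancel_left dvd_trans le_imp_power_dvd
          le_trans less_eq_Suc_le)
    then have "uniformizer ^ j dvd y \<longleftrightarrow> uniformizer ^ j dvd x" if "j \<le> Suc k" for j
      using that by (metis diff_add_cancel dvd_add_right_iff)
    then have "uniformizer ^ k dvd y \<longleftrightarrow> uniformizer ^ k dvd x"
      "uniformizer ^ Suc k dvd y \<longleftrightarrow> uniformizer ^ Suc k dvd x" by (simp_all del: power_Suc)
    with \<open>y \<in> S\<close> x show ?thesis unfolding A_def by blast
  qed
  have Am: "A k \<in> sets borel" for k by (rule residue_invariant_measure(1)[OF inv])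
  \<comment> \<open>Multiplication by p^k matches the unit residues below p^e with the numbers below
    p^(k+e) of valuation exactly \<open>k\<close>.\<close>
  have count: "card {r. r < CARD('p) ^ (k + e) \<and> of_nat r \<in> A k} = unit_count S k" for k
    unfolding unit_count_def e_def[symmetric]
  proof (rule bij_betw_same_card[of "\<lambda>r. CARD('p) ^ k * r", symmetric], rule bij_betw_imageI)
    let ?B = "{r. r < CARD('p) ^ e \<and> \<not> CARD('p) dvd r \<and> of_nat (CARD('p) ^ k * r) \<in> S}"
    show "inj_on (\<lambda>r. CARD('p) ^ k * r) ?B" by (auto simp: inj_on_def)
    have mem: "of_nat (CARD('p) ^ k * r) \<in> A k \<longleftrightarrow> \<not> CARD('p) dvd r \<and> of_nat (CARD('p) ^ k * r) \<in> S" for r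
      unfolding A_def mem_Collect_eq uniformizer_power_dvd_of_nat_iff by (auto simp: mult.commute)
    show "(\<lambda>r. CARD('p) ^ k * r) ` ?B = {r. r < CARD('p) ^ (k + e) \<and> of_nat r \<in> A k}"
    proof (intro equalityI subsetI)
      fix t assume t: "t \<in> {r. r < CARD('p) ^ (k + e) \<and> of_nat r \<in> A k}"
      then have "CARD('p) ^ k dvd t"
        unfolding A_def by (simp add: uniformizer_power_dvd_of_nat_iff)
      then obtain r where r: "t = CARD('p) ^ k * r" by blast
      then have "of_nat (CARD('p) ^ k * r) \<in> A k" "r < CARD('p) ^ e" using t by (simp_all add: power_add)
      then have "r \<in> ?B" using mem[of r] by blast
      with r show "t \<in> (\<lambda>r. CARD('p) ^ k * r) ` ?B" by blast
    next
      fix t assume "t \<in> (\<lambda>r. CARD('p) ^ k * r) ` ?B"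
      then obtain r where r: "t = CARD('p) ^ k * r" "r \<in> ?B" by blast
      then have "of_nat t \<in> A k" using mem[of r] by blast
      moreover have "t < CARD('p) ^ (k + e)" using r by (simp add: power_add)
      ultimately show "t \<in> {r. r < CARD('p) ^ (k + e) \<and> of_nat r \<in> A k}" by blast
    qed
  qed
  have mA: "measure ?\<mu> (A k) = unit_count S k / q ^ (k + e)" for k
    using residue_invariant_measure(2)[OF inv, of k] count[of k] by (simp add: q_def)
  have disj: "disjoint_family A"
  proof -
    have "A j \<inter> A k = {}" if "j < k" for j k
    proof -
      have "uniformizer ^ Suc j dvd (uniformizer :: 'p padic_int) ^ k"
        using that by (intro le_imp_power_dvd) simp
      then show ?thesis unfolding A_def by (blast dest: dvd_trans)
    qed
    then show ?thesis unfolding disjoint_family_on_def by (metis Int_commute linorder_neqE_nat)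
  qed
  have UA: "S - {0} = (\<Union>k. A k)"
  proof (intro equalityI subsetI)
    fix x assume x: "x \<in> S - {0}"
    then obtain k v where kv: "x = uniformizer ^ k * v" "\<not> uniformizer dvd v"
      using padic_valuation_cases by blast
    then have "x \<in> A k" using x uniformizer_power_dvd_unit_mult[OF kv(2), of "Suc k" k] by (simp add: A_def)
    then show "x \<in> (\<Union>k. A k)" by blast
  qed (auto simp: A_def)
  \<comment> \<open>The point 0, the only one outside all layers, lies in residue classes of measure
    q^(-n) for every n.\<close>
  have zero: "{0 :: 'p padic_int} \<in> sets borel \<and> measure ?\<mu> {0} = 0"
  proof -
    let ?C = "\<lambda>n. residue_class (0 :: 'p padic_int) n"
    have C: "?C n \<in> sets borel" for n by (intro borel_open open_residue_class)
    have "{0 :: 'p padic_int} = (\<Inter>n. ?C n)"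
      by (auto intro: padic_int_eqI)
    then have 0: "{0 :: 'p padic_int} \<in> sets borel" using C by auto
    have "measure ?\<mu> {0} \<le> (1 / q) ^ n" for n
    proof -
      have "measure ?\<mu> {0} \<le> measure ?\<mu> (?C n)"
        by (rule finite_measure_mono) (use C sets in auto)
      also have "\<dots> = (1 / q) ^ n"
        by (simp only: measure_residue_class) (simp add: power_divide q_def)
      finally show ?thesis .
    qed
    moreover have "(\<lambda>n. (1 / q) ^ n) \<longlonglongrightarrow> 0" by (rule LIMSEQ_realpow_zero) (use q in auto)
    ultimately have "measure ?\<mu> {0} \<le> 0" by (intro LIMSEQ_le_const) auto
    then show ?thesis using 0 measure_nonneg[of ?\<mu> "{0}"] by (metis antisym)
  qed
  have mS: "measure ?\<mu> S = measure ?\<mu> (\<Union>k. A k)"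
  proof -
    have U: "(\<Union>k. A k) \<in> sets ?\<mu>" unfolding sets using Am by blast
    have "measure ?\<mu> (S - {0} \<union> {0}) = measure ?\<mu> (\<Union>k. A k)"
      unfolding UA by (rule measure_Un_null_set[OF U]) (use zero sets in \<open>simp add: null_sets_def emeasure_eq_measure\<close>)
    moreover have "measure ?\<mu> (S - {0}) = measure ?\<mu> (\<Union>k. A k)" by (simp only: UA)
    ultimately show ?thesis by (cases "0 \<in> S") (simp_all add: insert_absorb)
  qed
  define a where "a k = unit_count S k / q ^ (k + e)" for k
  define s where "s = measure ?\<mu> S"
  have sums: "a sums s"
  proof -
    have "range A \<subseteq> sets ?\<mu>" unfolding sets using Am by blast
    from finite_measure_UNION[OF this disj] show ?thesis
      unfolding s_def mS mA a_def .
  qed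
  \<comment> \<open>Dropping two terms divides the series by q^2. Comparing with the sum minus those
    terms gives a linear equation for \<open>s\<close>.\<close>
  have "a (k + 2) = a k / q\<^sup>2" for k
    unfolding a_def unit_count_periodic[OF S] using q by (simp add: power_add power2_eq_square)
  then have "(\<lambda>k. a (k + 2)) sums (s / q\<^sup>2)"
    using sums_divide[OF sums, of "q\<^sup>2"] by simp
  moreover have "(\<lambda>k. a (k + 2)) sums (s - (\<Sum>k<2. a k))"
    by (rule sums_split_initial_segment[OF sums])
  ultimately have "s / q\<^sup>2 = s - (\<Sum>k<2. a k)"
    by (rule sums_unique2)
  then have "s / q\<^sup>2 = s - (a 0 + a 1)"
    by (simp add: numeral_2_eq_2)
  moreover have "a 0 = unit_count S 0 / q ^ e" "a 1 = unit_count S 1 / (q * q ^ e)"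
    by (simp_all add: a_def)
  ultimately show ?thesis
    using q unfolding s_def[symmetric] by (simp add: field_simps power2_eq_square)
qed

text \<open>In lowest terms m/n one has a n = m b with \<open>a\<close> odd and \<open>b\<close>
  even, so n is even and, by coprimality, m is odd.\<close>

lemma negative_2_valuation:
  fixes d :: real and a b :: int
  assumes "d * b = a" "odd a" "even b" "b \<noteq> 0"
  shows "\<exists>r :: rat. d = of_rat r \<and> rat_valuation 2 r < 0"
proof (intro exI conjI)
  let ?r = "of_int a / of_int b :: rat"
  show "d = of_rat ?r" using assms by (simp add: of_rat_divide field_simps)
  obtain m n where mn: "quotient_of ?r = (m, n)" by (metis surj_pair)
  have n: "n > 0" using quotient_of_denom_pos[OF mn] .
  have cop: "coprime m n" using quotient_of_coprime[OF mn] .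
  have "?r = of_int m / of_int n" using quotient_of_div[OF mn] .
  then have "of_int (a * n) = (of_int (m * b) :: rat)" using n assms by (simp add: field_simps)
  then have "a * n = m * b" by (simp only: of_int_eq_iff)
  then have "even n" using assms by (metis even_mult_iff)
  with cop have "odd m" by (metis coprime_common_divisor odd_one)
  then have "multiplicity 2 m = 0" by (simp add: not_dvd_imp_multiplicity_0)
  moreover have "multiplicity 2 n > 0" using \<open>even n\<close> n by (simp add: multiplicity_gt_zero_iff)
  ultimately show "rat_valuation 2 ?r < 0" by (simp add: rat_valuation_def mn)
qed

section \<open>Possible densities for odd \<open>p\<close>\<close>

lemma sq_closed_Compl: "sq_closed S \<Longrightarrow> sq_closed (- S)"
  by (simp add: sq_closed_def)

lemma unit_count_Compl:
  fixes S :: "'p :: prime_card padic_int set"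
  shows "unit_count S k + unit_count (- S) k
       = card {r. r < CARD('p) ^ sq_exponent TYPE('p) \<and> \<not> CARD('p) dvd r}"
proof -
  let ?R = "{r. r < CARD('p) ^ sq_exponent TYPE('p) \<and> \<not> CARD('p) dvd r}"
    and ?P = "\<lambda>r. of_nat (CARD('p) ^ k * r) \<in> S"
  have "card ?R = card {r \<in> ?R. ?P r} + card {r \<in> ?R. \<not> ?P r}"
    by (subst card_Un_disjoint[symmetric]) (auto simp del: of_nat_mult intro: arg_cong[where f = card])
  then show ?thesis by (simp add: unit_count_def conj_assoc del: of_nat_mult)
qed

text \<open>If \<open>r\<close> is counted then so are the residues of \<open>r s\<^sup>2\<close>, which are distinct for \<open>1 \<le> s \<le> h\<close>.\<close>

lemma unit_count_half:
  fixes S :: "'p :: prime_card padic_int set"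
  assumes S: "sq_closed S" and h: "CARD('p) = 2 * h + 1" "h > 0"
  shows "unit_count S k = 0 \<or> h \<le> unit_count S k"
proof -
  let ?p = "CARD('p)"
  let ?Q = "{r. r < ?p \<and> \<not> ?p dvd r \<and> of_nat (?p ^ k * r) \<in> S}"
  have e: "sq_exponent TYPE('p) = 1" using h by (simp add: sq_exponent_def)
  have Q: "unit_count S k = card ?Q" by (simp add: unit_count_def e)
  have p: "prime ?p" by (rule prime_card)
  have "h \<le> card ?Q" if r: "r \<in> ?Q" for r
  proof -
    let ?g = "\<lambda>s. r * (s * s) mod ?p"
    have nd: "\<not> ?p dvd s" if "s \<in> {1..h}" for s using that h by (auto dest: dvd_imp_le)
    have "?g s \<in> ?Q" if s: "s \<in> {1..h}" for s
    proof -
      have ng: "\<not> ?p dvd ?g s"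
        using r nd[OF s] p by (simp add: dvd_mod_iff prime_dvd_mult_iff)
      have "of_nat (?p ^ k * r) * (of_nat s * of_nat s) \<in> S"
        using r s S unfolding sq_closed_def by auto
      then have "of_nat (?p ^ k * (r * (s * s))) \<in> S" by (simp add: ac_simps)
      moreover have "uniformizer ^ (k + sq_exponent TYPE('p)) dvd
          (of_nat (?p ^ k * (r * (s * s))) - uniformizer ^ k * of_nat (?g s) :: 'p padic_int)"
      proof -
        have "?p dvd r * (s * s) - ?g s" by (simp add: dvd_minus_mod)
        then have "?p ^ (k + 1) dvd ?p ^ k * (r * (s * s) - ?g s)" by simp
        then have "uniformizer ^ (k + 1) dvd (of_nat (?p ^ k * (r * (s * s) - ?g s)) :: 'p padic_int)"
          by (simp only: uniformizer_power_dvd_of_nat_iff)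
        also have "(of_nat (?p ^ k * (r * (s * s) - ?g s)) :: 'p padic_int)
            = of_nat (?p ^ k * (r * (s * s))) - uniformizer ^ k * of_nat (?g s)"
          by (simp only: of_nat_mult of_nat_power of_nat_diff[OF mod_less_eq_dividend] right_diff_distrib)
        finally show ?thesis by (simp only: e)
      qed
      ultimately have "uniformizer ^ k * of_nat (?g s) \<in> S"
        using sq_closed_cong[OF S, of "of_nat (?g s)" k] ng uniformizer_dvd_of_nat_iff[of "?g s", where 'p = 'p]
        by blast
      then show ?thesis using ng h by simp
    qed
    moreover have "inj_on ?g {1..h}"
    proof (rule linorder_inj_onI)
      fix s t :: nat assume st: "s < t" "s \<in> {1..h}" "t \<in> {1..h}"
      show "?g s \<noteq> ?g t"
      proof
        assume "?g s = ?g t"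
        then have "?p dvd r * (t * t) - r * (s * s)"
          by (metis mod_eq_dvd_iff_nat mult_le_mono st(1) less_imp_le_nat order_refl)
        also have "r * (t * t) - r * (s * s) = r * ((t + s) * (t - s))"
          using st by (simp add: diff_mult_distrib2 diff_mult_distrib algebra_simps)
        \<comment> \<open>Both t + s and t - s lie strictly between 0 and p = 2h + 1, which rules
          out either divisibility.\<close>
        finally have "?p dvd t + s \<or> ?p dvd t - s"
          using r p by (simp add: prime_dvd_mult_iff)
        then show False using st h by (auto dest!: dvd_imp_le)
      qed
    qed auto
    ultimately have "card {1..h} \<le> card ?Q"
      by (intro card_inj_on_le[of ?g]) auto
    then show ?thesis by simp
  qed
  then show ?thesis unfolding Q by (cases "?Q = {}") auto
qed

text \<open>The counts for \<open>S\<close> and its complement add up to 2h, and each is 0 or at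
  least h.\<close>

lemma unit_count_odd_cases:
  fixes S :: "'p :: prime_card padic_int set"
  assumes S: "sq_closed S" and h: "CARD('p) = 2 * h + 1" "h > 0"
  shows "unit_count S k \<in> {0, h, 2 * h}"
proof -
  have "{r. r < CARD('p) \<and> \<not> CARD('p) dvd r} = {1..2 * h}"
    using h by (auto dest: dvd_imp_le simp: Suc_le_eq intro: gr0I)
  then have "unit_count S k + unit_count (- S) k = 2 * h"
    using unit_count_Compl[of S k] h by (simp add: sq_exponent_def)
  then show ?thesis
    using unit_count_half[OF S h, of k] unit_count_half[OF sq_closed_Compl[OF S] h, of k] by auto
qed

text \<open>A nonzero element of \<open>S\<close> makes the count at its valuation positive;
  periodicity moves this to valuation 0 or 1. This excludes density 0.\<close>

lemma unit_count_pos: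
  fixes S :: "'p :: prime_card padic_int set"
  assumes S: "sq_closed S" and x: "x \<in> S" "x \<noteq> 0"
  shows "unit_count S 0 > 0 \<or> unit_count S 1 > 0"
proof -
  let ?e = "sq_exponent TYPE('p)"
  obtain k v where kv: "x = uniformizer ^ k * v" "\<not> uniformizer dvd v"
    using padic_valuation_cases[OF x(2)] by blast
  define r where "r = nat (padic_res v ?e)"
  have r: "r < CARD('p) ^ ?e" "int r = padic_res v ?e"
    using padic_res_bounds[of v ?e] by (auto simp: r_def nat_less_iff)
  then have "padic_res (of_nat r :: 'p padic_int) ?e = padic_res v ?e"
    by (simp add: padic_res_of_nat)
  then have dvd: "uniformizer ^ ?e dvd of_nat r - v"
    by (simp only: padic_res_eq_iff)
  have "?e \<ge> 1" by (simp add: sq_exponent_def)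
  then have "uniformizer dvd of_nat r - v"
    using dvd_trans[OF le_imp_power_dvd dvd, of 1] by simp
  then have "\<not> CARD('p) dvd r"
    using kv(2) by (metis uniformizer_dvd_of_nat_iff diff_add_cancel dvd_add_right_iff dvd_diff_commute)
  moreover have "of_nat (CARD('p) ^ k * r) \<in> S"
  proof -
    have "uniformizer ^ (k + ?e) dvd of_nat (CARD('p) ^ k * r) - uniformizer ^ k * v"
      using mult_dvd_mono[OF dvd_refl dvd, of "uniformizer ^ k"] by (simp add: power_add right_diff_distrib)
    then show ?thesis using sq_closed_cong[OF S kv(2), of k] x kv by blast
  qed
  ultimately have "unit_count S k > 0"
    using r unfolding unit_count_def by (subst card_gt_0_iff) auto
  moreover have "unit_count S (2 * j + i) = unit_count S i" for j i
  proof (induction j)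
    case (Suc j)
    have "2 * Suc j + i = 2 * j + i + 2" by simp
    then show ?case using Suc unit_count_periodic[OF S, of "2 * j + i"] by (simp only:)
  qed simp
  then have "unit_count S k = unit_count S (k mod 2)"
    by (metis mult_div_mod_eq)
  ultimately show ?thesis
    by (cases "even k") (simp_all add: even_iff_mod_2_eq_zero odd_iff_mod_2_eq_one)
qed

lemma sq_closed_density_odd:
  fixes S :: "'p :: prime_card padic_int set"
  assumes S: "sq_closed S" and x: "x \<in> S" "x \<noteq> 0" and p: "CARD('p) > 2"
  shows "measure padic_haar S = 1 \<or> (\<exists>r :: rat. measure padic_haar S = of_rat r \<and> rat_valuation 2 r < 0)"
proof -
  let ?d = "measure padic_haar S"
  have "odd CARD('p)" using p prime_odd_nat[OF prime_card[where 'a = 'p]] by simp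
  then obtain h where h: "CARD('p) = 2 * h + 1" by (rule oddE)
  with p have h0: "h > 0" by simp
  have e: "sq_exponent TYPE('p) = 1" using p by (simp add: sq_exponent_def)
  obtain a where a: "unit_count S 0 = a * h" "a \<in> {0, 1, 2}"
    using unit_count_odd_cases[OF S h h0, of 0] that[of 0] that[of 1] that[of 2] by auto
  obtain b where b: "unit_count S 1 = b * h" "b \<in> {0, 1, 2}"
    using unit_count_odd_cases[OF S h h0, of 1] that[of 0] that[of 1] that[of 2] by auto
  have ab: "a \<noteq> 0 \<or> b \<noteq> 0" using unit_count_pos[OF S x] a b by auto
  define q where "q = real (2 * h + 1)"
  have "?d * (q\<^sup>2 - 1) * q = q * (q * (a * h) + b * h)"
    using sq_closed_measure[OF S] unfolding a b h e q_def by simp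
  then have "?d * (q\<^sup>2 - 1) = q * (a * h) + b * h"
    by (simp add: q_def)
  \<comment> \<open>The factor h here cancels the h common to both unit counts.\<close>
  moreover have "q\<^sup>2 - 1 = 4 * (h + 1) * h" by (simp add: q_def power2_eq_square algebra_simps)
  ultimately have "h * (?d * (4 * (h + 1))) = h * (a * q + b)"
    by (simp add: algebra_simps)
  then have "?d * (4 * (h + 1)) = a * q + b"
    using h0 by simp
  then have d: "?d * (4 * (real h + 1)) = a * (2 * real h + 1) + b"
    by (simp add: q_def algebra_simps)
  have neg: ?thesis if "?d * real_of_int y = real_of_int z" "odd z" "even y" "y \<noteq> 0" for y z
    using negative_2_valuation[OF that] by blast
  \<comment> \<open>The pair (2, 2) gives density 1 and (1, 1) gives 1/2. The others give an odd
    number over an even one, after halving the fraction for (0, 2) and (2, 0).\<close>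
  consider "a = 0" "b = 1" | "a = 0" "b = 2" | "a = 1" "b = 0" | "a = 1" "b = 1" | "a = 1" "b = 2"
    | "a = 2" "b = 0" | "a = 2" "b = 1" | "a = 2" "b = 2" using a(2) b(2) ab by (elim insertE emptyE) simp_all
  then show ?thesis
  proof cases
    case 1
    then show ?thesis using d by - (rule neg[of "4 * (int h + 1)" 1], simp_all add: algebra_simps)
  next
    case 2
    then show ?thesis using d by - (rule neg[of "2 * (int h + 1)" 1], simp_all add: algebra_simps)
  next
    case 3
    then show ?thesis using d by - (rule neg[of "4 * (int h + 1)" "2 * int h + 1"], simp_all add: algebra_simps)
  next
    case 4
    then have "?d * (4 * (real h + 1)) = 1 / 2 * (4 * (real h + 1))" using d by simp
    then have "?d = 1 / 2" by (subst (asm) mult_right_cancel) auto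
    then show ?thesis by - (rule neg[of 2 1], simp_all add: algebra_simps)
  next
    case 5
    then show ?thesis using d by - (rule neg[of "4 * (int h + 1)" "2 * int h + 3"], simp_all add: algebra_simps)
  next
    case 6
    then show ?thesis using d by - (rule neg[of "2 * (int h + 1)" "2 * int h + 1"], simp_all add: algebra_simps)
  next
    case 7
    then show ?thesis using d by - (rule neg[of "4 * (int h + 1)" "4 * int h + 3"], simp_all add: algebra_simps)
  next
    case 8
    then have "?d * (4 * (real h + 1)) = 1 * (4 * (real h + 1))" using d by simp
    then have "?d = 1" by (subst (asm) mult_right_cancel) auto
    then show ?thesis by simp
  qed
qed

section \<open>Quadratic forms and orthogonal vectors\<close>

lemma qform_smult: "qform c (a *s x) = a * a * qform c x"
  unfolding qform_def by (simp add: sum_distrib_left ac_simps)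

lemma polar_eq_sum: "polar c x y = (\<Sum>i\<in>UNIV. \<Sum>j\<in>UNIV. (c $ i $ j + c $ j $ i) * x $ i * y $ j)"
proof -
  have "(\<Sum>i\<in>UNIV. \<Sum>j\<in>UNIV. c $ i $ j * y $ i * x $ j) = (\<Sum>i\<in>UNIV. \<Sum>j\<in>UNIV. c $ j $ i * y $ j * x $ i)"
    by (rule sum.swap)
  then show ?thesis
    unfolding polar_def qform_def by (simp add: algebra_simps sum.distrib)
qed

lemma polar_commute: "polar c x y = polar c y x"
  unfolding polar_def by (simp add: add.commute)

lemma polar_add_right: "polar c x (y + z) = polar c x y + polar c x z"
  unfolding polar_eq_sum by (simp add: algebra_simps sum.distrib)

lemma polar_smult_right: "polar c x (a *s y) = a * polar c x y"
  unfolding polar_eq_sum by (simp add: sum_distrib_left ac_simps)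

lemma polar_add_left: "polar c (x + y) z = polar c x z + polar c y z"
  unfolding polar_eq_sum by (simp add: algebra_simps sum.distrib)

lemma polar_smult_left: "polar c (a *s x) y = a * polar c x y"
  unfolding polar_eq_sum by (simp add: sum_distrib_left ac_simps)

lemma polar_zero_right: "polar c x 0 = 0"
  unfolding polar_eq_sum by simp

lemma polar_sum_right: "finite L \<Longrightarrow> polar c x (\<Sum>w\<in>L. g w) = (\<Sum>w\<in>L. polar c x (g w))"
  by (induction L rule: finite_induct) (simp_all add: polar_zero_right polar_add_right)

lemma polar_self: "polar c x x = 2 * qform c x"
proof -
  have "x + x = 2 *s x" by (simp add: vec_eq_iff)
  then show ?thesis unfolding polar_def by (simp add: qform_smult)
qed

lemma qform_add: "qform c (x + y) = qform c x + qform c y + polar c x y"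
  by (simp add: polar_def)

text \<open>A homogeneous system with fewer equations than unknowns has a nonzero solution. Padding
  it with zero rows to a square matrix leaves row \<open>k\<close> zero, so the matrix is
  singular.\<close>

lemma ex_common_kernel:
  fixes \<alpha> :: "'b \<Rightarrow> 'a :: field ^ 'n"
  assumes "finite L" "card L < CARD('n)"
  obtains u where "u \<noteq> 0" "\<And>w. w \<in> L \<Longrightarrow> (\<Sum>j\<in>UNIV. \<alpha> w $ j * u $ j) = 0"
proof -
  obtain k :: 'n where True by blast
  have "card L \<le> card (UNIV - {k})" using assms by simp
  then obtain g where g: "inj_on g L" "g ` L \<subseteq> UNIV - {k}"
    using assms(1) by (metis card_le_inj finite)
  define A :: "'a ^ 'n ^ 'n" where "A = (\<chi> i. if i \<in> g ` L then \<alpha> (inv_into L g i) else 0)"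
  have "\<not> (\<exists>B. A ** B = mat 1)"
  proof
    assume "\<exists>B. A ** B = mat 1"
    then obtain B where "A ** B = mat 1" by blast
    then have "(A ** B) $ k $ k = 1" by (simp add: mat_def)
    moreover have "A $ k = 0" using g(2) by (auto simp: A_def)
    ultimately show False by (simp add: matrix_matrix_mult_def)
  qed
  then have "\<not> (\<exists>B. B ** A = mat 1)" by (metis matrix_left_right_inverse)
  then obtain u where u: "A *v u = 0" "u \<noteq> 0" by (auto simp: matrix_left_invertible_ker)
  have "(\<Sum>j\<in>UNIV. \<alpha> w $ j * u $ j) = 0" if w: "w \<in> L" for w
  proof -
    have "(A *v u) $ g w = 0" by (simp add: u)
    moreover have "A $ g w = \<alpha> w" using w g(1) by (simp add: A_def)
    ultimately show ?thesis by (simp add: matrix_vector_mult_def)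
  qed
  with u(2) show ?thesis by (rule that)
qed

text \<open>One step of diagonalisation. Take a nonzero \<open>u\<close> orthogonal to
  \<open>L\<close>, choose \<open>y\<close> pairing nontrivially with it, and project
  \<open>y\<close> to a vector \<open>z\<close> orthogonal to \<open>L\<close>. One of
  \<open>u\<close>, \<open>z\<close>, \<open>u + z\<close> is then anisotropic.\<close>

lemma extend_orthogonal:
  fixes c :: "'a :: field ^ 'n ^ 'n"
  assumes nondeg: "\<And>x. (\<And>y. polar c x y = 0) \<Longrightarrow> x = 0" and two: "(2 :: 'a) \<noteq> 0"
    and L: "finite L" "card L < CARD('n)"
    and orth: "\<And>v w. v \<in> L \<Longrightarrow> w \<in> L \<Longrightarrow> v \<noteq> w \<Longrightarrow> polar c v w = 0"
    and aniso: "\<And>w. w \<in> L \<Longrightarrow> qform c w \<noteq> 0"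
  obtains v where "qform c v \<noteq> 0" "\<And>w. w \<in> L \<Longrightarrow> polar c w v = 0"
proof -
  define \<alpha> where "\<alpha> w = (\<chi> j. \<Sum>i\<in>UNIV. (c $ i $ j + c $ j $ i) * w $ i)" for w
  have pol: "polar c w u = (\<Sum>j\<in>UNIV. \<alpha> w $ j * u $ j)" for w u
    unfolding polar_eq_sum \<alpha>_def by (subst sum.swap) (simp add: sum_distrib_right)
  obtain u where u: "u \<noteq> 0" "\<And>w. w \<in> L \<Longrightarrow> polar c w u = 0"
    by (rule ex_common_kernel[OF L, of \<alpha>]) (simp add: pol)
  then obtain y where y: "polar c u y \<noteq> 0" using nondeg by blast
  \<comment> \<open>The Gram-Schmidt coefficient: the denominator is \<open>polar c w w\<close>,
    whence the need for 2 to be nonzero.\<close>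
  define g where "g w = (- polar c w y / (2 * qform c w)) *s w" for w
  define z where "z = y + sum g L"
  have z0: "polar c w z = 0" if w: "w \<in> L" for w
  proof -
    have "polar c w (g v) = (if v = w then - polar c w y else 0)" if "v \<in> L" for v
    proof -
      have "polar c w (g v) = - polar c v y / (2 * qform c v) * polar c w v"
        unfolding g_def by (rule polar_smult_right)
      then show ?thesis using orth[OF w that] aniso[OF w] two by (auto simp: polar_self)
    qed
    then have "(\<Sum>v\<in>L. polar c w (g v)) = (\<Sum>v\<in>L. if v = w then - polar c w y else 0)"
      by (rule sum.cong[OF refl])
    then show ?thesis using w L by (simp add: z_def polar_add_right polar_sum_right)
  qed
  have "polar c u (g v) = 0" if "v \<in> L" for v
    using u(2)[OF that] unfolding g_def polar_smult_right polar_commute[of c u] by simp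
  then have uz: "polar c u z \<noteq> 0" using y L by (simp add: z_def polar_add_right polar_sum_right)
  \<comment> \<open>If \<open>u\<close> and \<open>z\<close> are both isotropic, the form at their
    sum equals their pairing. This is nonzero, since the projection did not change the pairing of
    \<open>u\<close> with \<open>y\<close>.\<close>
  show ?thesis
  proof (cases "qform c u = 0 \<and> qform c z = 0")
    case True
    then have "qform c (u + z) \<noteq> 0" using uz by (simp add: qform_add)
    then show ?thesis using that[of "u + z"] u z0 by (simp add: polar_add_right)
  next
    case False
    then show ?thesis using that[of u] that[of z] u z0 by blast
  qed
qed

section \<open>ADC forms and square classes\<close>

lemma qform_base_change: "qform (base_change c) (\<chi> i. to_fract (x $ i)) = to_fract (qform c x)"
  by (simp add: qform_def base_change_def)

text \<open>For t = m/n, multiplying by n^2 instead of n clears the denominator without leaving the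
  square class.\<close>

lemma fract_times_square:
  fixes t :: "'a :: idom fract"
  obtains a b where "b \<noteq> 0" "to_fract a = t * (to_fract b * to_fract b)" 
proof -
  obtain m n where "t = to_fract m / to_fract n" "n \<noteq> 0"
    by (cases t) (simp add: Fract_conv_to_fract)
  then show ?thesis using that[of n "m * n"] by simp
qed

lemma ADC_iff: 
  fixes f :: "'p :: prime_card padic_int ^ 'n ^ 'n"
  assumes "ADC f"
  shows "x \<in> range (qform f) \<longleftrightarrow> (\<exists>w. qform (base_change f) w = to_fract x)"
  using assms qform_base_change[of f] unfolding ADC_def by (metis rangeE rangeI)

text \<open>Vectors may be rescaled by \<open>s\<close> and by its inverse over the fraction field;
  ADC brings the resulting representations back to integral vectors.\<close>

lemma ADC_sq_closed:
  fixes f :: "'p :: prime_card padic_int ^ 'n ^ 'n"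
  assumes f: "ADC f"
  shows "sq_closed (range (qform f))"
  unfolding sq_closed_def ADC_iff[OF f]
proof (intro allI impI iffI)
  fix x s :: "'p padic_int" assume s: "s \<noteq> 0"
  {
    assume "\<exists>w. qform (base_change f) w = to_fract (x * (s * s))"
    then obtain w where "qform (base_change f) w = to_fract (x * (s * s))" by blast
    then have "qform (base_change f) ((1 / to_fract s) *s w) = to_fract x"
      using s by (simp add: qform_smult)
    then show "\<exists>w. qform (base_change f) w = to_fract x" by blast
  next
    assume "\<exists>w. qform (base_change f) w = to_fract x"
    then obtain w where "qform (base_change f) w = to_fract x" by blast
    then have "qform (base_change f) (to_fract s *s w) = to_fract (x * (s * s))"
      by (simp add: qform_smult)
    then show "\<exists>w. qform (base_change f) w = to_fract (x * (s * s))" by blast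
  }
qed

lemma ADC_ex_nonzero:
  fixes f :: "'p :: prime_card padic_int ^ 'n ^ 'n"
  assumes f: "ADC f" and nondeg: "nondegenerate f"
  shows "\<exists>x \<in> range (qform f). x \<noteq> 0"
proof -
  have "\<exists>w. qform (base_change f) w \<noteq> 0"
  proof (rule ccontr)
    assume "\<nexists>w. qform (base_change f) w \<noteq> 0"
    then have "polar (base_change f) x y = 0" for x y by (simp add: polar_def)
    \<comment> \<open>The all-ones vector serves merely as a nonzero vector in the radical.\<close>
    then have "(1 :: 'p padic ^ 'n) = 0" using nondeg unfolding nondegenerate_def by blast
    then show False by (simp add: vec_eq_iff)
  qed
  then obtain w where w: "qform (base_change f) w \<noteq> 0" by blast
  obtain a b where ab: "b \<noteq> 0" "to_fract a = qform (base_change f) w * (to_fract b * to_fract b)"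
    by (rule fract_times_square)
  then have "qform (base_change f) (to_fract b *s w) = to_fract a" by (simp add: qform_smult)
  then have "a \<in> range (qform f)" using ADC_iff[OF f] by blast
  moreover have "a \<noteq> 0" using ab w by (metis mult_eq_0_iff to_fract_eq_0_iff)
  ultimately show ?thesis by blast
qed

section \<open>Ternary forms over the \<open>2\<close>-adic numbers\<close>

text \<open>The representative in \<open>sq_reps\<close> of the square class of \<open>m\<close> in \<open>\<rat>\<^sub>2\<close> (and \<open>0\<close> at \<open>0\<close>).\<close>

fun sq_class :: "int \<Rightarrow> int" where
  "sq_class m = (if m = 0 then 0 else if m mod 4 = 0 then sq_class (m div 4)
     else if even m then 2 * ((m div 2) mod 8) else m mod 8)"

declare sq_class.simps [simp del]

definition sq_reps :: "int list" where
  "sq_reps = [1, 3, 5, 7, 2, 6, 10, 14]"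

text \<open>Found by computer search: these points suffice to exhibit seven square classes for every one of the
  diagonal forms.\<close>

definition sample_points :: "(int \<times> int \<times> int) list" where
  "sample_points =
    [(0, 0, 1), (0, 1, 0), (0, 1, 1), (0, 1, 2), (0, 1, 3), (0, 2, 1), (1, 0, 0),
     (1, 0, 1), (1, 0, 2), (1, 0, 3), (1, 1, 0), (1, 1, 1), (1, 1, 2), (1, 2, 0),
     (1, 2, 2), (2, 0, 1), (2, 1, 0), (2, 1, 1), (2, 2, 1), (3, 1, 0), (3, 2, 1)]"

definition sample_classes :: "int \<Rightarrow> int \<Rightarrow> int \<Rightarrow> int list" where
  "sample_classes a b c =
     map (\<lambda>(x, y, z). sq_class (a * (x * x) + b * (y * y) + c * (z * z))) sample_points"

text \<open>Excluding class 0 ensures that the seven distinct classes come from nonzero values.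
  Seven is the best uniform bound: x^2 + y^2 + z^2 misses the class of 7.\<close>

lemma length_sample_classes:
  "\<forall>a\<in>set sq_reps. \<forall>b\<in>set sq_reps. \<forall>c\<in>set sq_reps.
     7 \<le> length (remdups (sample_classes a b c)) \<and> 0 \<notin> set (sample_classes a b c)"
  by code_simp

text \<open>For p = 2 the relevant precision is 8, so the odd part may be reduced modulo 8.\<close>

lemma sq_closed_two_adic:
  fixes S :: "'p :: prime_card padic_int set"
  assumes S: "sq_closed S" and two: "CARD('p) = 2" and n: "odd n"
  shows "of_int (2 ^ k * (n mod 8)) \<in> S \<longleftrightarrow> of_int (2 ^ k * n) \<in> S"
proof -
  let ?n = "of_int n :: 'p padic_int"
  have "\<not> uniformizer dvd ?n"
    using uniformizer_power_dvd_of_int_iff[of 1 n, where 'p = 'p] n by (simp add: two)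
  moreover have "uniformizer ^ (k + sq_exponent TYPE('p)) dvd of_int (2 ^ k * (n mod 8)) - uniformizer ^ k * ?n"
  proof -
    have "(2 :: int) ^ (k + 3) dvd 2 ^ k * (n mod 8 - n)"
      by (simp add: power_add mod_eq_dvd_iff[symmetric])
    then have "uniformizer ^ (k + sq_exponent TYPE('p)) dvd (of_int (2 ^ k * (n mod 8 - n)) :: 'p padic_int)"
      unfolding uniformizer_power_dvd_of_int_iff by (simp add: two sq_exponent_def)
    then show ?thesis by (simp add: two right_diff_distrib)
  qed
  ultimately have "of_int (2 ^ k * (n mod 8)) \<in> S \<longleftrightarrow> uniformizer ^ k * ?n \<in> S"
    by (rule sq_closed_cong[OF S])
  then show ?thesis by (simp add: two)
qed

text \<open>Induction along the recursion: division by 4 removes a square, and the remaining odd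
  part is reduced modulo 8.\<close>

lemma sq_class_mem:
  fixes S :: "'p :: prime_card padic_int set"
  assumes S: "sq_closed S" and two: "CARD('p) = 2"
  shows "m \<noteq> 0 \<Longrightarrow> of_int m \<in> S \<Longrightarrow> sq_class m \<in> set sq_reps \<and> of_int (sq_class m) \<in> S"
proof (induction m rule: sq_class.induct)
  case (1 m)
  have odd8: "n mod 8 \<in> {1, 3, 5, 7}" if "odd n" for n :: int
    using that by (simp; presburger)
  consider "m mod 4 = 0" | "m mod 4 \<noteq> 0" "even m" | "odd m" by blast
  then show ?case
  proof cases
    case 1
    then have m: "m = m div 4 * 4" by presburger
    then have "of_int m = of_int (m div 4) * (2 * 2 :: 'p padic_int)"
      by (metis (mono_tags, lifting) of_int_mult of_int_numeral mult_2 numeral_Bit0)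
    then have "of_int (m div 4) \<in> S"
      using "1.prems"(2) S unfolding sq_closed_def by (metis zero_neq_numeral)
    moreover have "m div 4 \<noteq> 0" using m "1.prems"(1) by auto
    ultimately show ?thesis
      using "1.IH" "1.prems"(1) \<open>m mod 4 = 0\<close> by (simp add: sq_class.simps[of m])
  next
    case 2
    then have m: "m = 2 ^ 1 * (m div 2)" by simp
    have o: "odd (m div 2)" using 2 by presburger
    have "of_int (2 ^ 1 * (m div 2 mod 8)) \<in> S"
      using sq_closed_two_adic[OF S two o, of 1] "1.prems"(2) m by metis
    then show ?thesis
      using 2 odd8[OF o] "1.prems"(1) by (auto simp: sq_class.simps[of m] sq_reps_def)
  next
    case 3
    then have "m mod 4 \<noteq> 0" by presburger
    moreover have "of_int (m mod 8) \<in> S"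
      using sq_closed_two_adic[OF S two 3, of 0] "1.prems"(2) by simp
    ultimately show ?thesis
      using 3 odd8[OF 3] "1.prems"(1) by (auto simp: sq_class.simps[of m] sq_reps_def)
  qed
qed

lemma to_fract_of_nat [simp]: "to_fract (of_nat n) = of_nat n"
  by (induction n) simp_all

lemma to_fract_of_int [simp]: "to_fract (of_int n) = of_int n"
  by (cases n rule: int_cases2) simp_all

lemma two_adic_sq_rep:
  fixes t :: "'p :: prime_card padic"
  assumes two: "CARD('p) = 2" and t: "t \<noteq> 0"
  obtains \<rho> s where "\<rho> \<in> set sq_reps" "s \<noteq> 0" "t * (s * s) = of_int \<rho>"
proof -
  \<comment> \<open>The integral elements with a representative form a square-closed set, so
    \<open>sq_closed_cong\<close> applies to \<open>T\<close> itself and reduces the claim to a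
    power of 2 times 1, 3, 5 or 7.\<close>
  define T where "T = {x :: 'p padic_int. \<exists>\<rho>\<in>set sq_reps. \<exists>s. s \<noteq> 0 \<and> to_fract x * (s * s) = of_int \<rho>}"
  have T: "sq_closed T"
    unfolding sq_closed_def
  proof (intro allI impI iffI)
    fix x c :: "'p padic_int" assume c: "c \<noteq> 0"
    {
      assume "x * (c * c) \<in> T"
      then obtain \<rho> s where *: "\<rho> \<in> set sq_reps" "s \<noteq> 0" "to_fract (x * (c * c)) * (s * s) = of_int \<rho>"
        unfolding T_def by blast
      then have "to_fract x * ((to_fract c * s) * (to_fract c * s)) = of_int \<rho>" by (simp add: ac_simps)
      moreover have "to_fract c * s \<noteq> 0" using * c by simp
      ultimately show "x \<in> T" using * unfolding T_def by blast
    next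
      assume "x \<in> T"
      then obtain \<rho> s where *: "\<rho> \<in> set sq_reps" "s \<noteq> 0" "to_fract x * (s * s) = of_int \<rho>"
        unfolding T_def by blast
      then have "to_fract (x * (c * c)) * ((s / to_fract c) * (s / to_fract c)) = of_int \<rho>" using c by simp
      moreover have "s / to_fract c \<noteq> 0" using * c by simp
      ultimately show "x * (c * c) \<in> T" using * unfolding T_def by blast
    }
  qed
  have rep: "of_int \<rho> \<in> T" if "\<rho> \<in> set sq_reps" for \<rho>
    unfolding T_def using that by (intro CollectI bexI[of _ \<rho>] exI[of _ 1]) simp_all
  obtain x b where xb: "b \<noteq> 0" "to_fract x = t * (to_fract b * to_fract b)" by (rule fract_times_square)
  then have "x \<noteq> 0" using t by (metis mult_eq_0_iff to_fract_eq_0_iff)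
  then obtain k v where kv: "x = uniformizer ^ k * v" "\<not> uniformizer dvd v"
    by (rule padic_valuation_cases)
  define r where "r = padic_res v 3"
  have e: "sq_exponent TYPE('p) = 3" by (simp add: sq_exponent_def two)
  have "padic_res (of_int r :: 'p padic_int) 3 = padic_res v 3" by (simp add: r_def padic_res_of_int)
  then have dvd: "uniformizer ^ 3 dvd of_int r - v" by (simp only: padic_res_eq_iff)
  have "odd r"
  proof
    assume "even r"
    then have "uniformizer dvd (of_int r :: 'p padic_int)"
      using uniformizer_power_dvd_of_int_iff[of 1 r, where 'p = 'p] by (simp add: two)
    moreover have "uniformizer dvd of_int r - v"
      using dvd_trans[OF le_imp_power_dvd dvd, of 1] by simp
    ultimately have "uniformizer dvd of_int r - (of_int r - v)" by (rule dvd_diff)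
    with kv(2) show False by simp
  qed
  moreover have "0 \<le> r" "r < 8" using padic_res_bounds[of v 3] by (simp_all add: r_def two)
  ultimately have r: "r \<in> {1, 3, 5, 7}" by (simp; presburger)
  have "uniformizer ^ (k + 3) dvd uniformizer ^ k * of_int r - uniformizer ^ k * v"
    using mult_dvd_mono[OF dvd_refl dvd, of "uniformizer ^ k"] by (simp add: power_add right_diff_distrib)
  then have "uniformizer ^ k * of_int r \<in> T \<longleftrightarrow> x \<in> T"
    unfolding kv(1) by (intro sq_closed_cong[OF T kv(2)]) (simp only: e)
  moreover have "uniformizer ^ k * of_int r \<in> T"
  proof -
    \<comment> \<open>The even part of the exponent is a square; what remains is one of the listed
      representatives.\<close>
    let ?m = "2 ^ (k mod 2) * r" and ?c = "uniformizer ^ (k div 2) :: 'p padic_int"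
    have "?m \<in> set sq_reps"
      using r by (cases "even k") (auto simp: sq_reps_def even_iff_mod_2_eq_zero odd_iff_mod_2_eq_one)
    then have "of_int ?m \<in> T" by (rule rep)
    then have "of_int ?m * (?c * ?c) \<in> T" using T two unfolding sq_closed_def
      by (metis of_nat_numeral power_not_zero zero_neq_numeral)
    moreover have "(uniformizer :: 'p padic_int) ^ k = uniformizer ^ (k mod 2) * (?c * ?c)"
      by (simp flip: power_add mult_2)
    then have "of_int ?m * (?c * ?c) = uniformizer ^ k * of_int r"
      by (simp add: two ac_simps)
    ultimately show ?thesis by (simp only:)
  qed
  ultimately have "x \<in> T" by simp
  then obtain \<rho> s where *: "\<rho> \<in> set sq_reps" "s \<noteq> 0" "to_fract x * (s * s) = of_int \<rho>"
    unfolding T_def by blast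
  have "t * ((to_fract b * s) * (to_fract b * s)) = of_int \<rho>" using * xb by (simp add: ac_simps)
  moreover have "to_fract b * s \<noteq> 0" using * xb by simp
  ultimately show ?thesis using *(1) that by blast
qed

text \<open>Three successive orthogonal anisotropic vectors diagonalise the form, and rescaling puts
  its coefficients in \<open>sq_reps\<close>, where the finite check applies.\<close>

lemma ternary_two_adic_classes:
  fixes f :: "'p :: prime_card padic_int ^ 'n ^ 'n"
  assumes nondeg: "nondegenerate f" and adc: "ADC f" and n: "CARD('n) = 3" and two: "CARD('p) = 2"
  shows "7 \<le> card {t \<in> set sq_reps. of_int t \<in> range (qform f)}"
proof -
  let ?q = "qform (base_change f)" and ?b = "polar (base_change f)"
  have nd: "x = 0" if "\<And>y. ?b x y = 0" for x
    using that nondeg unfolding nondegenerate_def by blast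
  have "(2 :: 'p padic) = to_fract 2" by (metis to_fract_of_nat of_nat_numeral)
  then have char: "(2 :: 'p padic) \<noteq> 0" by (metis to_fract_eq_0_iff zero_neq_numeral)
  note ext = extend_orthogonal[of "base_change f", OF nd char]
  obtain u where u: "?q u \<noteq> 0" by (rule ext[of "{}"]) (auto simp: n)
  obtain v where v: "?q v \<noteq> 0" "?b u v = 0" by (rule ext[of "{u}"]) (use u n in auto)
  have card: "card {u, v} < CARD('n)" using card_insert_le_m1[of 2 "{v}" u] n by simp
  obtain w where w: "?q w \<noteq> 0" "?b u w = 0" "?b v w = 0"
    by (rule ext[of "{u, v}"]) (use card u v in \<open>auto simp: polar_commute[of _ v u]\<close>)
  obtain a r where a: "a \<in> set sq_reps" "?q u * (r * r) = of_int a"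
    by (rule two_adic_sq_rep[OF two u])
  obtain b s where b: "b \<in> set sq_reps" "?q v * (s * s) = of_int b"
    by (rule two_adic_sq_rep[OF two v(1)])
  obtain c t where c: "c \<in> set sq_reps" "?q w * (t * t) = of_int c"
    by (rule two_adic_sq_rep[OF two w(1)])
  \<comment> \<open>The scaled vectors are orthogonal with values \<open>a\<close>,
    \<open>b\<close>, \<open>c\<close>, and ADC makes the integral values of the diagonal form
    values of \<open>f\<close> on integral vectors.\<close>
  have repr: "of_int (a * (x * x) + b * (y * y) + c * (z * z)) \<in> range (qform f)" for x y z
  proof -
    have "?q ((of_int x * r) *s u + (of_int y * s) *s v + (of_int z * t) *s w)
        = (?q u * (r * r)) * (of_int x * of_int x) + (?q v * (s * s)) * (of_int y * of_int y)
          + (?q w * (t * t)) * (of_int z * of_int z)"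
      unfolding qform_add polar_add_left qform_smult polar_smult_left polar_smult_right
      using v w by (simp add: ac_simps)
    also have "\<dots> = to_fract (of_int (a * (x * x) + b * (y * y) + c * (z * z)))"
      by (simp add: a b c)
    finally show ?thesis using ADC_iff[OF adc] by blast
  qed
  have "set (sample_classes a b c) \<subseteq> {t \<in> set sq_reps. of_int t \<in> range (qform f)}"
  proof
    fix d assume d: "d \<in> set (sample_classes a b c)"
    then obtain x y z where xyz: "d = sq_class (a * (x * x) + b * (y * y) + c * (z * z))"
      unfolding sample_classes_def by auto
    have "d \<noteq> 0" using d length_sample_classes a b c by blast
    then have "a * (x * x) + b * (y * y) + c * (z * z) \<noteq> 0"
      unfolding xyz by (metis sq_class.simps)
    then show "d \<in> {t \<in> set sq_reps. of_int t \<in> range (qform f)}"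
      using sq_class_mem[OF ADC_sq_closed[OF adc] two _ repr] unfolding xyz by blast
  qed
  then have "card (set (sample_classes a b c)) \<le> card {t \<in> set sq_reps. of_int t \<in> range (qform f)}"
    by (intro card_mono) auto
  moreover have "7 \<le> card (set (sample_classes a b c))"
    using length_sample_classes a b c by (simp add: length_remdups_card_conv)
  ultimately show ?thesis by simp
qed

section \<open>The density at \<open>p = 2\<close> and the conclusion\<close>

lemma sq_closed_density_two:
  fixes S :: "'p :: prime_card padic_int set"
  assumes S: "sq_closed S" and two: "CARD('p) = 2" and C: "7 \<le> card {t \<in> set sq_reps. of_int t \<in> S}"
  shows "measure padic_haar S = 1 \<or> (\<exists>r :: rat. measure padic_haar S = of_rat r \<and> rat_valuation 2 r < 0)"
proof -
  let ?d = "measure padic_haar S"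
  have e: "sq_exponent TYPE('p) = 3" by (simp add: sq_exponent_def two)
  have odds: "{r :: nat. r < 8 \<and> odd r} = {1, 3, 5, 7}" by (auto; presburger)
  have count: "unit_count S k = card {r \<in> {1, 3, 5, 7}. of_nat (2 ^ k * r) \<in> S}" for k
  proof -
    have "{r. r < 8 \<and> odd r \<and> of_nat (2 ^ k * r) \<in> S} = {r \<in> {r. r < 8 \<and> odd r}. of_nat (2 ^ k * r) \<in> S}"
      by blast
    then show ?thesis unfolding unit_count_def e two odds by simp
  qed
  have le4: "unit_count S k \<le> 4" for k
  proof -
    have "unit_count S k \<le> card {1, 3, 5, 7 :: nat}" unfolding count by (rule card_mono) auto
    then show ?thesis by simp
  qed
  have "{t \<in> set sq_reps. of_int t \<in> S} \<subseteq> int ` {r \<in> {1, 3, 5, 7}. of_nat (2 ^ 0 * r) \<in> S}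
      \<union> (\<lambda>r. 2 * int r) ` {r \<in> {1, 3, 5, 7}. of_nat (2 ^ 1 * r) \<in> S}" (is "?C \<subseteq> int ` ?U0 \<union> ?g ` ?U1")
    by (auto simp: sq_reps_def image_iff)
  then have "card ?C \<le> card (int ` ?U0 \<union> ?g ` ?U1)" by (intro card_mono) auto
  also have "\<dots> \<le> card (int ` ?U0) + card (?g ` ?U1)" by (rule card_Un_le)
  also have "\<dots> \<le> unit_count S 0 + unit_count S 1"
    unfolding count by (intro add_mono card_image_le) auto
  finally have "7 \<le> unit_count S 0 + unit_count S 1" using C by simp
  \<comment> \<open>Two counts of at most 4 with sum at least 7 leave three cases. The general
    measure formula with q = 2 and e = 3 turns them into 1, 10/12 and 11/12.\<close>
  with le4[of 0] le4[of 1] consider "unit_count S 0 = 4" "unit_count S 1 = 4"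
    | "unit_count S 0 = 3" "unit_count S 1 = 4" | "unit_count S 0 = 4" "unit_count S 1 = 3" by linarith
  moreover have d: "?d * 12 = 2 * unit_count S 0 + unit_count S 1"
    using sq_closed_measure[OF S] by (simp add: two e)
  ultimately show ?thesis
  proof cases
    case 1
    then show ?thesis using d by simp
  next
    case 2
    then show ?thesis using d negative_2_valuation[of ?d 6 5] by simp
  next
    case 3
    then show ?thesis using d negative_2_valuation[of ?d 12 11] by simp
  qed
qed

theorem theorem2p7:
  fixes f :: "'p :: prime_card padic_int ^ 'n ^ 'n"
  assumes "nondegenerate f"
    and "ADC f"
    and "CARD('n) = 3 \<or> CARD('p) > 2"
  shows "repr_density f = 1 \<or> (\<exists>r :: rat. repr_density f = of_rat r \<and> rat_valuation 2 r < 0)"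
proof (cases "CARD('p) = 2")
  case True
  with assms have "CARD('n) = 3" by simp
  then show ?thesis
    unfolding repr_density_def
    by (intro sq_closed_density_two ADC_sq_closed ternary_two_adic_classes assms True)
next
  case False
  then have "CARD('p) > 2" using prime_ge_2_nat[OF prime_card[where 'a = 'p]] by simp
  moreover obtain x where "x \<in> range (qform f)" "x \<noteq> 0"
    using ADC_ex_nonzero[OF assms(2,1)] by blast
  ultimately show ?thesis
    unfolding repr_density_def using sq_closed_density_odd[OF ADC_sq_closed[OF assms(2)]] by blast
qed

end
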